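(* Suppose that $q_0$ is locally polyhedral with constants $\epsilon,L>0$ independent of $V$, i.e. $q_0(\boldsymbol U_0^* )\ge q_0(\boldsymbol U)+L\|\boldsymbol U_0^*-\boldsymbol U\|$ for all $\boldsymbol U\succeq\boldsymbol 0$ with $\|\boldsymbol U-\boldsymbol U_0^*\|<\epsilon$, and that a steady state distribution exists for the backlog process generated by QLA. Then with a sufficiently large $V$, under FQLA-Ideal, $$\overline U=O(\log^2(V)),\qquad f_{av}^{FI}=f_{av}^*+O(1/V),\qquad P_{drop}=O(1/V^{c_0\log(V)}),$$ where $c_0=\Theta(1)$, $\overline U$ is the time average backlog, $f_{av}^{FI}$ is the time average cost of FQLA-Ideal, $f_{av}^*$ is the optimal time average cost, and $P_{drop}$ is the time average fraction of packets that are dropped in Step II(b) of FQLA-Ideal.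
   Context: Network model. Time is slotted, $t=0,1,2,\dots$; there are $r\ge1$ queues. The network state $S(t)$ takes values in a finite set $\mathcal S=\{s_1,\dots,s_M\}$ and is i.i.d. over slots with $p_{s_i}=\Pr\{S(t)=s_i\}$. When $S(t)=s_i$, the controller observes $s_i$ and chooses an action $x$ in a compact feasible set $\mathcal X^{(s_i)}$; this incurs cost $f(t)=f(s_i,x)$ (the function $f$ is either everywhere nonnegative or everywhere nonpositive), arrivals $A_j(t)=g_j(s_i,x)\ge0$ to queue $j$ and service $\mu_j(t)=b_j(s_i,x)\ge0$ of queue $j$, $j=1,\dots,r$. The magnitudes of $f,g_j,b_j$ are bounded by a constant $\delta_{max}\in(0,\infty)$. Slackness: there are actions $x^{(s_i)k}\in\mathcal X^{(s_i)}$, $k=1,\dots,r+2$, and weights $\vartheta_k^{(s_i)}\ge0$ with $\sum_k\vartheta_k^{(s_i)}=1$ for each $s_i$, and some $\epsilon_s>0$, such that $\sum_{s_i}p_{s_i}\sum_k\vartheta_k^{(s_i)}[g_j(s_i,x^{(s_i)k})-b_j(s_i,x^{(s_i)k})]\le-\epsilon_s$ for all $j$. The backlog vector $\boldsymbol U(t)=(U_1(t),\dots,U_r(t))^T$ (without packet dropping) satisfies $\boldsymbol U(0)=\boldsymbol 0$ and $U_j(t+1)=\max[U_j(t)-\mu_j(t),0]+A_j(t)$. $\|\cdot\|$ is the Euclidean norm, $\succeq$ is entrywise. Averages: time average backlog $\overline U=\limsup_{t\to\infty}\frac1t\sum_{\tau=0}^{t-1}\sum_j\mathbb E\{U_j(\tau)\}$;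 time average cost of a policy $\pi$ is $f^\pi_{av}=\limsup_{t\to\infty}\frac1t\sum_{\tau=0}^{t-1}\mathbb E\{f^\pi(\tau)\}$. A policy is stable if its time average backlog (without packet dropping) is finite; $f^*_{av}$ is the optimal (infimum) time average cost over all stable policies. QLA with parameter $V\ge1$: at each slot $t$, given $\boldsymbol U(t)$ and $S(t)=s_i$, choose $x\in\mathcal X^{(s_i)}$ maximizing $-Vf(s_i,x)+\sum_jU_j(t)[b_j(s_i,x)-g_j(s_i,x)]$. Dual function: $q(\boldsymbol U)=\inf_{x^{(s_i)}\in\mathcal X^{(s_i)}}\sum_{s_i}p_{s_i}\{Vf(s_i,x^{(s_i)})+\sum_jU_j[g_j(s_i,x^{(s_i)})-b_j(s_i,x^{(s_i)})]\}$; $\boldsymbol U_V^*=(U^*_{V1},\dots,U^*_{Vr})^T$ denotes the maximizer of $q$ over $\boldsymbol U\succeq\boldsymbol 0$, assumed unique for every $V\ge1$. $q_0$ and $\boldsymbol U_0^*$ denote $q$ and its maximizer when $V=1$. FQLA-Ideal ($\boldsymbol U_V^*$ known). Step I: set $\mathcal W_j=\max[U^*_{Vj}-\log^2(V),0]$ for each $j$. Step II: initialize $U_j(0)=0$, $W_j(0)=\mathcal W_j$ for all $j$. At each slot $t\ge 0$, observe $S(t)=s_i$ and choose $x\in\mathcal X^{(s_i)}$ maximizing the QLA objective with $\boldsymbol W(t)$ in place of $\boldsymbol U(t)$; let $A_j(t),\mu_j(t)$ be the resulting arrivals and services and $f(t)$ the cost. For each queue $j$: (a) if $W_j(t)\ge\mathcal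 W_j$, set $U_j(t+1)=\max[U_j(t)-\mu_j(t),0]+A_j(t)$; (b) if $W_j(t)<\mathcal W_j$, admit only $\tilde A_j(t)=\max[A_j(t)-\mathcal W_j+W_j(t),0]$ arrivals (the other $A_j(t)-\tilde A_j(t)$ packets are dropped) and set $U_j(t+1)=\max[U_j(t)-\mu_j(t),0]+\tilde A_j(t)$; (c) in all cases set $W_j(t+1)=\max[W_j(t)-\mu_j(t),0]+A_j(t)$. $P_{drop}$ is the long-run ratio of the expected number of packets dropped in (b), $\sum_{\tau<t}\sum_j\mathbb E\{A_j(\tau)-\tilde A_j(\tau)\}$, to the expected number of packets generated, $\sum_{\tau<t}\sum_j\mathbb E\{A_j(\tau)\}$. Asymptotic notation refers to $V\to\infty$ with all other problem data fixed.
   Formalization: The bound on P_drop is asserted only for those V for which the expected number of packets generated tends to infinity with time; if it stays finite, the initial transient never averages out and the stated bound can fail. *)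

theory Defs
  imports "HOL-Probability.Probability"
begin

text \<open>
  Static problem data. The network states are the elements of the finite type \<open>'s\<close>, the queues are
  indexed by the finite type \<open>'r\<close> (so \<open>r = CARD('r) \<ge> 1\<close>), and backlog vectors live in \<open>real ^ 'r\<close>.
\<close>

record ('s, 'x, 'r) network =
  state_prob :: "'s \<Rightarrow> real"
  feasible :: "'s \<Rightarrow> 'x set"
  cost :: "'s \<Rightarrow> 'x \<Rightarrow> real"
  arrival :: "'s \<Rightarrow> 'x \<Rightarrow> real ^ 'r"
  service :: "'s \<Rightarrow> 'x \<Rightarrow> real ^ 'r"

text \<open>
  The probability space \<open>M\<close> carries the i.i.d. network state process \<open>S\<close>. The filtration \<open>F\<close> is the
  information available to the controller: \<open>F t\<close> contains the states up to and including slot \<open>t\<close>,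
  possibly together with independent randomization, but nothing about later states.
\<close>

locale stochastic_network = prob_space M
  for M :: "'w measure" +
  fixes F :: "nat \<Rightarrow> 'w measure"
    and S :: "nat \<Rightarrow> 'w \<Rightarrow> 's::finite"
    and N :: "('s, 'x::topological_space, 'r::finite) network"
    and \<delta> :: real
  assumes subalgebra_F: "subalgebra M (F t)"
    and mono_F: "t \<le> t' \<Longrightarrow> sets (F t) \<subseteq> sets (F t')"
    and adapted_S: "S t \<in> measurable (F t) (count_space UNIV)"
    and indep_S: "indep_vars (\<lambda>_. count_space UNIV) S UNIV"
    and distr_S: "prob {\<omega> \<in> space M. S t \<omega> = s} = state_prob N s"
    and indep_past: "indep_set (sets (F t)) {S (Suc t) -` B \<inter> space M | B. True}"
    and compact_feasible: "compact (feasible N s)"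
    and delta_pos: "0 < \<delta>"
    and cost_bound: "x \<in> feasible N s \<Longrightarrow> \<bar>cost N s x\<bar> \<le> \<delta>"
    and cost_sign: "(\<forall>s. \<forall>x\<in>feasible N s. 0 \<le> cost N s x) \<or> (\<forall>s. \<forall>x\<in>feasible N s. cost N s x \<le> 0)"
    and arrival_bound: "x \<in> feasible N s \<Longrightarrow> 0 \<le> arrival N s x $ j \<and> arrival N s x $ j \<le> \<delta>"
    and service_bound: "x \<in> feasible N s \<Longrightarrow> 0 \<le> service N s x $ j \<and> service N s x $ j \<le> \<delta>"
    and slackness: "\<exists>(y :: 's \<Rightarrow> nat \<Rightarrow> 'x) (\<theta> :: 's \<Rightarrow> nat \<Rightarrow> real) \<epsilon>.
      0 < \<epsilon> \<and>
      (\<forall>s. \<forall>k\<in>{1..CARD('r) + 2}. y s k \<in> feasible N s \<and> 0 \<le> \<theta> s k) \<and>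
      (\<forall>s. (\<Sum>k=1..CARD('r) + 2. \<theta> s k) = 1) \<and>
      (\<forall>j. (\<Sum>s\<in>UNIV. state_prob N s *
              (\<Sum>k=1..CARD('r) + 2. \<theta> s k * (arrival N s (y s k) $ j - service N s (y s k) $ j))) \<le> - \<epsilon>)"

definition time_avg :: "(nat \<Rightarrow> real) \<Rightarrow> ereal" where
  "time_avg h = limsup (\<lambda>t. ereal ((\<Sum>\<tau><t. h \<tau>) / real t))"

primrec queue :: "real ^ 'r \<Rightarrow> (nat \<Rightarrow> real ^ 'r) \<Rightarrow> (nat \<Rightarrow> real ^ 'r) \<Rightarrow> nat \<Rightarrow> real ^ 'r" where
  "queue u0 \<mu> a 0 = u0"
| "queue u0 \<mu> a (Suc t) = (\<chi> j. max (queue u0 \<mu> a t $ j - \<mu> t $ j) 0 + a t $ j)"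

text \<open>In the following, \<open>x t \<omega>\<close> is the action taken in slot \<open>t\<close>.\<close>

definition costs where
  "costs N S x t \<omega> = cost N (S t \<omega>) (x t \<omega>)"

definition arrivals where
  "arrivals N S x t \<omega> = arrival N (S t \<omega>) (x t \<omega>)"

definition services where
  "services N S x t \<omega> = service N (S t \<omega>) (x t \<omega>)"

definition backlog ::
    "('s, 'x, 'r::finite) network \<Rightarrow> (nat \<Rightarrow> 'w \<Rightarrow> 's) \<Rightarrow> (nat \<Rightarrow> 'w \<Rightarrow> 'x) \<Rightarrow> nat \<Rightarrow> 'w \<Rightarrow> real ^ 'r" where
  "backlog N S x t \<omega> = queue 0 (\<lambda>\<tau>. services N S x \<tau> \<omega>) (\<lambda>\<tau>. arrivals N S x \<tau> \<omega>) t"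

text \<open>
  The action sets carry no \<open>\<sigma>\<close>-algebra, so causality (and measurability) is imposed on
  everything an action influences: the cost, the arrivals and the services.
\<close>

definition policy ::
    "('s, 'x, 'r::finite) network \<Rightarrow> (nat \<Rightarrow> 'w measure) \<Rightarrow> (nat \<Rightarrow> 'w \<Rightarrow> 's) \<Rightarrow> (nat \<Rightarrow> 'w \<Rightarrow> 'x) \<Rightarrow> bool" where
  "policy N F S x \<longleftrightarrow>
     (\<forall>t. \<forall>\<omega>\<in>space (F t). x t \<omega> \<in> feasible N (S t \<omega>)) \<and>
     (\<forall>t. costs N S x t \<in> borel_measurable (F t) \<and>
          arrivals N S x t \<in> borel_measurable (F t) \<and>
          services N S x t \<in> borel_measurable (F t))"

definition avg_backlog :: "'w measure \<Rightarrow> (nat \<Rightarrow> 'w \<Rightarrow> real ^ 'r) \<Rightarrow> ereal" where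
  "avg_backlog M Q = time_avg (\<lambda>\<tau>. \<Sum>j\<in>UNIV. integral\<^sup>L M (\<lambda>\<omega>. Q \<tau> \<omega> $ j))"

definition avg_cost where
  "avg_cost M N S x = time_avg (\<lambda>\<tau>. integral\<^sup>L M (costs N S x \<tau>))"

definition stable where
  "stable M N S x \<longleftrightarrow> avg_backlog M (backlog N S x) < \<infinity>"

definition opt_avg_cost where
  "opt_avg_cost M F N S = (INF x \<in> {x. policy N F S x \<and> stable M N S x}. avg_cost M N S x)"

definition dual :: "('s::finite, 'x, 'r::finite) network \<Rightarrow> real \<Rightarrow> real ^ 'r \<Rightarrow> real" where
  "dual N V u = (INF y \<in> {y. \<forall>s. y s \<in> feasible N s}.
     \<Sum>s\<in>UNIV. state_prob N s *
       (V * cost N s (y s) + (\<Sum>j\<in>UNIV. u $ j * (arrival N s (y s) $ j - service N s (y s) $ j))))"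

definition dual_max :: "('s::finite, 'x, 'r::finite) network \<Rightarrow> real \<Rightarrow> real ^ 'r" where
  "dual_max N V = arg_max (dual N V) (\<lambda>u. \<forall>j. 0 \<le> u $ j)"

definition locally_polyhedral :: "(real ^ 'r \<Rightarrow> real) \<Rightarrow> real ^ 'r \<Rightarrow> real \<Rightarrow> real \<Rightarrow> bool" where
  "locally_polyhedral q u0 \<epsilon> L \<longleftrightarrow>
     (\<forall>u. (\<forall>j. 0 \<le> u $ j) \<and> norm (u - u0) < \<epsilon> \<longrightarrow> q u0 \<ge> q u + L * norm (u0 - u))"

definition qla_action ::
    "('s, 'x, 'r::finite) network \<Rightarrow> real \<Rightarrow> real ^ 'r \<Rightarrow> 's \<Rightarrow> 'x \<Rightarrow> bool" where
  "qla_action N V u s = is_arg_max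
     (\<lambda>x. - V * cost N s x + (\<Sum>j\<in>UNIV. u $ j * (service N s x $ j - arrival N s x $ j)))
     (\<lambda>x. x \<in> feasible N s)"

text \<open>Ties between maximizing actions may be broken by any causal rule.\<close>

definition qla where
  "qla N F S V x \<longleftrightarrow> policy N F S x \<and>
     (\<forall>t. \<forall>\<omega>\<in>space (F t). qla_action N V (backlog N S x t \<omega>) (S t \<omega>) (x t \<omega>))"

text \<open>
  Convergence of the time-averaged laws to a probability distribution, tested on bounded continuous
  functions. This is implied by convergence of the laws themselves and, unlike the latter, also
  covers periodic processes.
\<close>

definition has_steady_state :: "'w measure \<Rightarrow> (nat \<Rightarrow> 'w \<Rightarrow> real ^ 'r) \<Rightarrow> bool" where
  "has_steady_state M Q \<longleftrightarrow>
     (\<exists>\<nu> :: (real ^ 'r) measure. prob_space \<nu> \<and> sets \<nu> = sets borel \<and>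
        (\<forall>h :: real ^ 'r \<Rightarrow> real. continuous_on UNIV h \<and> bounded (range h) \<longrightarrow>
           (\<lambda>t. (\<Sum>\<tau><t. integral\<^sup>L M (\<lambda>\<omega>. h (Q \<tau> \<omega>))) / real t) \<longlonglongrightarrow> integral\<^sup>L \<nu> h))"

definition fqla_offset :: "('s::finite, 'x, 'r::finite) network \<Rightarrow> real \<Rightarrow> real ^ 'r" where
  "fqla_offset N V = (\<chi> j. max (dual_max N V $ j - (ln V)\<^sup>2) 0)"

definition fqla_virtual ::
    "('s::finite, 'x, 'r::finite) network \<Rightarrow> (nat \<Rightarrow> 'w \<Rightarrow> 's) \<Rightarrow> real \<Rightarrow> (nat \<Rightarrow> 'w \<Rightarrow> 'x) \<Rightarrow> nat \<Rightarrow> 'w \<Rightarrow> real ^ 'r" where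
  "fqla_virtual N S V x t \<omega> =
     queue (fqla_offset N V) (\<lambda>\<tau>. services N S x \<tau> \<omega>) (\<lambda>\<tau>. arrivals N S x \<tau> \<omega>) t"

definition fqla_admitted ::
    "('s::finite, 'x, 'r::finite) network \<Rightarrow> (nat \<Rightarrow> 'w \<Rightarrow> 's) \<Rightarrow> real \<Rightarrow> (nat \<Rightarrow> 'w \<Rightarrow> 'x) \<Rightarrow> nat \<Rightarrow> 'w \<Rightarrow> real ^ 'r" where
  "fqla_admitted N S V x t \<omega> =
     (\<chi> j. if fqla_virtual N S V x t \<omega> $ j \<ge> fqla_offset N V $ j
           then arrivals N S x t \<omega> $ j
           else max (arrivals N S x t \<omega> $ j - fqla_offset N V $ j + fqla_virtual N S V x t \<omega> $ j) 0)"

definition fqla_backlog ::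
    "('s::finite, 'x, 'r::finite) network \<Rightarrow> (nat \<Rightarrow> 'w \<Rightarrow> 's) \<Rightarrow> real \<Rightarrow> (nat \<Rightarrow> 'w \<Rightarrow> 'x) \<Rightarrow> nat \<Rightarrow> 'w \<Rightarrow> real ^ 'r" where
  "fqla_backlog N S V x t \<omega> =
     queue 0 (\<lambda>\<tau>. services N S x \<tau> \<omega>) (\<lambda>\<tau>. fqla_admitted N S V x \<tau> \<omega>) t"

definition fqla_ideal where
  "fqla_ideal N F S V x \<longleftrightarrow> policy N F S x \<and>
     (\<forall>t. \<forall>\<omega>\<in>space (F t). qla_action N V (fqla_virtual N S V x t \<omega>) (S t \<omega>) (x t \<omega>))"

definition expected_generated where
  "expected_generated M N S x t =
     (\<Sum>\<tau><t. \<Sum>j\<in>UNIV. integral\<^sup>L M (\<lambda>\<omega>. arrivals N S x \<tau> \<omega> $ j))"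

definition expected_dropped where
  "expected_dropped M N S V x t =
     (\<Sum>\<tau><t. \<Sum>j\<in>UNIV. integral\<^sup>L M (\<lambda>\<omega>. arrivals N S x \<tau> \<omega> $ j - fqla_admitted N S V x \<tau> \<omega> $ j))"

text \<open>
  A meaningful long-run quantity only if the expected number of generated packets is unbounded;
  otherwise the initial transient never averages out.
\<close>

definition drop_fraction :: "'w measure \<Rightarrow> ('s::finite, 'x, 'r::finite) network \<Rightarrow> (nat \<Rightarrow> 'w \<Rightarrow> 's) \<Rightarrow>
    real \<Rightarrow> (nat \<Rightarrow> 'w \<Rightarrow> 'x) \<Rightarrow> ereal" where
  "drop_fraction M N S V x =
     limsup (\<lambda>t. ereal (expected_dropped M N S V x t / expected_generated M N S x t))"

end

theory Submission
  imports Defs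
begin

text \<open>
  The virtual backlog \<open>W\<close> of FQLA-Ideal is an ordinary queue vector that starts within distance of
  order \<open>(ln V)\<^sup>2\<close> of the dual maximizer \<open>u\<^sup>*\<close> and is controlled by the QLA rule with \<open>W\<close> as prices.
  Everything follows from the way in which this rule drives \<open>W\<close> towards \<open>u\<^sup>*\<close>.

  The dual function is concave, and the dual function for \<open>V\<close> is a rescaling of the one for
  \<open>V = 1\<close>. Therefore the local slope \<open>L\<close> at the maximizer holds on the whole orthant and for
  every \<open>V\<close> (\<open>dual_slope_scaled\<close>). As the QLA action minimizes the Lagrangian at the prices \<open>W\<close>,
  the mean net input is a supergradient of the dual function at \<open>W\<close>, so the distance \<open>Y\<close> between
  \<open>W\<close> and \<open>u\<^sup>*\<close> has drift at most \<open>- L / 2\<close> outside a fixed radius \<open>D\<close>. Since steps are bounded,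
  \<open>exp (\<eta> * Y)\<close> is a Lyapunov function for some fixed \<open>\<eta> > 0\<close>, and its time average is bounded
  uniformly in \<open>V\<close>.

  The real backlog exceeds the rise of \<open>W\<close> above its initial value by at most \<open>\<delta>\<close>
  (\<open>admitted_queue_le_virtual_excess\<close>), hence it is at most \<open>(ln V)\<^sup>2 + \<delta> + Y\<close>, which gives the bound
  on the average backlog. A packet of queue \<open>j\<close> is dropped only while \<open>W\<close> is below its initial value
  in that coordinate; then \<open>Y > (ln V)\<^sup>2\<close>, an event whose frequency is at most of order
  \<open>exp (- \<eta> * (ln V)\<^sup>2) = 1 / V powr (\<eta> * ln V)\<close>.

  The drop fraction compares drops with packets generated, and packets may be generated at a
  vanishing rate. So it is not enough to bound the exponential moment per slot. The point of
  \<open>sum_far_moment_le_generated\<close> is that inside radius \<open>D\<close> the Lyapunov function grows at most in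
  proportion to the distance moved by the queues, and since every departure needs an earlier arrival
  or initial backlog, the total movement is at most twice the number of packets generated plus a
  constant.

  For the cost, the quadratic Lyapunov function gives the upper bound \<open>q + O(1 / V)\<close>, where \<open>q\<close> is
  the maximum of the dual function for \<open>V = 1\<close> (\<open>avg_cost_le\<close>), and weak duality shows that no
  stable policy has a lower average cost than \<open>q\<close> (\<open>dual_le_avg_cost_stable\<close>). Conversely the actions
  of FQLA-Ideal form a stable policy themselves, because their undropped backlog from empty
  queues never exceeds \<open>W\<close> (\<open>policy_stable\<close>); so their cost is at least the optimal one.
\<close>

section \<open>Queue trajectories\<close>

lemma queue_nonneg:
  assumes "\<And>j. 0 \<le> w $ j" and "\<And>\<tau> j. 0 \<le> a \<tau> $ j"
  shows "0 \<le> queue w \<mu> a t $ j"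
  by (induction t) (simp_all add: assms add_nonneg_nonneg)

lemma queue_mono_initial:
  assumes "\<And>j. v $ j \<le> w $ j"
  shows "queue v \<mu> a t $ j \<le> queue w \<mu> a t $ j"
proof (induction t)
  case (Suc t)
  then show ?case by (simp add: max_def)
qed (simp add: assms)

lemma queue_le_initial_plus:
  assumes "\<And>j. 0 \<le> w $ j" and "\<And>\<tau> j. 0 \<le> a \<tau> $ j \<and> a \<tau> $ j \<le> d" and "\<And>\<tau> j. 0 \<le> \<mu> \<tau> $ j"
  shows "queue w \<mu> a t $ j \<le> w $ j + real t * d"
proof (induction t)
  case (Suc t)
  have "0 \<le> queue w \<mu> a t $ j" using assms by (intro queue_nonneg) auto
  moreover have "0 \<le> \<mu> t $ j" "a t $ j \<le> d" using assms by auto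
  ultimately show ?case using Suc by (simp add: algebra_simps max_def)
qed simp

lemma sum_net_input_le_queue:
  "(\<Sum>\<tau><t. a \<tau> $ j - \<mu> \<tau> $ j) \<le> queue 0 \<mu> a t $ j"
proof (induction t)
  case (Suc t)
  then show ?case by (simp add: max_def)
qed simp

text \<open>
  The rule for dropping packets is built so that the real queue follows the excess of the virtual
  queue over its initial value: while the virtual queue is below that value, only the part of the
  arrivals that lifts it above is admitted. The slack \<open>d\<close> pays for slots in which service of
  the real queue is wasted, after which it holds at most the arrivals of that slot.
\<close>

lemma admitted_queue_le_virtual_excess:
  assumes w: "\<And>j. 0 \<le> w $ j" and a: "\<And>\<tau> j. 0 \<le> a \<tau> $ j \<and> a \<tau> $ j \<le> d"
    and \<mu>: "\<And>\<tau> j. 0 \<le> \<mu> \<tau> $ j"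
    and a': "\<And>\<tau> j. a' \<tau> $ j = (if queue w \<mu> a \<tau> $ j \<ge> w $ j then a \<tau> $ j
               else max (a \<tau> $ j - w $ j + queue w \<mu> a \<tau> $ j) 0)"
  shows "queue 0 \<mu> a' t $ j \<le> max (queue w \<mu> a t $ j - w $ j) 0 + d"
proof (induction t)
  case 0
  have "0 \<le> d" using a[of 0 undefined] by linarith
  then show ?case by simp
next
  case (Suc t)
  have "0 \<le> \<mu> t $ j" "0 \<le> a t $ j" "a t $ j \<le> d" using \<mu> a by auto
  with Suc show ?case by (simp add: a' max_def split: if_splits)
qed

text \<open>
  While no service is wasted, the backlog moves by exactly \<open>a - \<mu>\<close>. When the subtraction is
  truncated at \<open>0\<close>, what remains in the queue is closer to the nonnegative point \<open>c\<close> than the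
  negative difference would be, so truncation costs no more than a constant.
\<close>

lemma queue_step_quadratic:
  fixes x c a \<mu> d :: real
  assumes "0 \<le> x" "0 \<le> c" "0 \<le> a" "a \<le> d" "0 \<le> \<mu>" "\<mu> \<le> d"
  shows "(max (x - \<mu>) 0 + a - c)\<^sup>2 \<le> (x - c)\<^sup>2 + 2 * ((x - c) * (a - \<mu>)) + 3 * d\<^sup>2"
proof -
  have am: "(a - \<mu>)\<^sup>2 \<le> d\<^sup>2"
    using assms by (intro abs_le_square_iff[THEN iffD1]) auto
  have eq: "(x - \<mu> + a - c)\<^sup>2 = (x - c)\<^sup>2 + 2 * ((x - c) * (a - \<mu>)) + (a - \<mu>)\<^sup>2"
    by (simp add: power2_eq_square algebra_simps)
  show ?thesis
  proof (cases "\<mu> \<le> x")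
    case True
    then have "max (x - \<mu>) 0 = x - \<mu>" by simp
    then show ?thesis using eq am zero_le_power2[of d] unfolding \<open>max (x - \<mu>) 0 = x - \<mu>\<close> by linarith
  next
    case False
    \<comment> \<open>The unused service \<open>\<mu> - x\<close> costs at most \<open>2 * d\<^sup>2\<close>, because \<open>c\<close> is nonnegative.\<close>
    have "(a - c)\<^sup>2 = (x - \<mu> + a - c)\<^sup>2 + (\<mu> - x) * (2 * a - 2 * c - (\<mu> - x))"
      by (simp add: power2_eq_square algebra_simps)
    moreover have "(\<mu> - x) * (2 * a - 2 * c - (\<mu> - x)) \<le> (\<mu> - x) * (2 * a)"
      using False assms by (intro mult_left_mono) auto
    moreover have "(\<mu> - x) * (2 * a) \<le> d * (2 * d)"
      using False assms by (intro mult_mono) auto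
    moreover have "max (x - \<mu>) 0 = 0" using False by simp
    ultimately show ?thesis using eq am by (simp add: power2_eq_square)
  qed
qed

lemma power2_norm_vec: "(norm (u :: real ^ 'n))\<^sup>2 = (\<Sum>j\<in>UNIV. (u $ j)\<^sup>2)"
  by (simp add: norm_vec_def L2_set_def sum_nonneg)

lemma queue_step_norm:
  fixes w c :: "real ^ 'r" and d :: real
  assumes "\<And>j. 0 \<le> queue w \<mu> a t $ j" "\<And>j. 0 \<le> c $ j"
    and "\<And>j. 0 \<le> a t $ j \<and> a t $ j \<le> d" "\<And>j. 0 \<le> \<mu> t $ j \<and> \<mu> t $ j \<le> d"
  shows "(norm (queue w \<mu> a (Suc t) - c))\<^sup>2 \<le> (norm (queue w \<mu> a t - c))\<^sup>2
    + 2 * (\<Sum>j\<in>UNIV. (queue w \<mu> a t $ j - c $ j) * (a t $ j - \<mu> t $ j)) + 3 * real CARD('r) * d\<^sup>2"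
proof -
  have "(norm (queue w \<mu> a (Suc t) - c))\<^sup>2 =
      (\<Sum>j\<in>UNIV. (max (queue w \<mu> a t $ j - \<mu> t $ j) 0 + a t $ j - c $ j)\<^sup>2)"
    by (simp add: power2_norm_vec)
  also have "\<dots> \<le> (\<Sum>j\<in>UNIV. (queue w \<mu> a t $ j - c $ j)\<^sup>2
      + 2 * ((queue w \<mu> a t $ j - c $ j) * (a t $ j - \<mu> t $ j)) + 3 * d\<^sup>2)"
    using assms by (intro sum_mono queue_step_quadratic) auto
  also have "\<dots> = (norm (queue w \<mu> a t - c))\<^sup>2
      + 2 * (\<Sum>j\<in>UNIV. (queue w \<mu> a t $ j - c $ j) * (a t $ j - \<mu> t $ j)) + 3 * real CARD('r) * d\<^sup>2"
    by (simp add: power2_norm_vec sum.distrib flip: sum_distrib_left)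
  finally show ?thesis .
qed

text \<open>
  Two bounds on how far a backlog vector moves in one slot. The second one is linear in the arrivals
  up to a telescoping term; it is what allows packet drops to be compared with packets generated,
  however rarely packets are generated.
\<close>

lemma queue_step_diff:
  fixes w c :: "real ^ 'r" and d \<Delta> :: real
  assumes q: "\<And>j. 0 \<le> queue w \<mu> a t $ j"
    and a: "\<And>j. 0 \<le> a t $ j \<and> a t $ j \<le> d" and \<mu>: "\<And>j. 0 \<le> \<mu> t $ j \<and> \<mu> t $ j \<le> d"
  defines "\<Delta> \<equiv> \<bar>norm (queue w \<mu> a (Suc t) - c) - norm (queue w \<mu> a t - c)\<bar>"
  shows "\<Delta> \<le> CARD('r) * d"
    and "\<Delta> \<le> (\<Sum>j\<in>UNIV. 2 * a t $ j - (queue w \<mu> a (Suc t) $ j - queue w \<mu> a t $ j))"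
proof -
  let ?q = "queue w \<mu> a"
  have "\<Delta> \<le> norm (?q (Suc t) - ?q t)"
    unfolding \<Delta>_def using norm_triangle_ineq3[of "?q (Suc t) - c" "?q t - c"] by simp
  also have "\<dots> \<le> (\<Sum>j\<in>UNIV. \<bar>(?q (Suc t) - ?q t) $ j\<bar>)" by (rule norm_le_l1_cart)
  finally have l1: "\<Delta> \<le> (\<Sum>j\<in>UNIV. \<bar>(?q (Suc t) - ?q t) $ j\<bar>)" .
  have "\<bar>(?q (Suc t) - ?q t) $ j\<bar> \<le> d" for j
    using q[of j] a[of j] \<mu>[of j] by (auto simp: max_def)
  then have "(\<Sum>j\<in>UNIV. \<bar>(?q (Suc t) - ?q t) $ j\<bar>) \<le> (\<Sum>j\<in>(UNIV::'r set). d)"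
    by (intro sum_mono)
  with l1 show "\<Delta> \<le> CARD('r) * d" by simp
  have "\<bar>(?q (Suc t) - ?q t) $ j\<bar> \<le> 2 * a t $ j - (?q (Suc t) $ j - ?q t $ j)" for j
    using q[of j] a[of j] \<mu>[of j] by (auto simp: max_def)
  then have "(\<Sum>j\<in>UNIV. \<bar>(?q (Suc t) - ?q t) $ j\<bar>)
      \<le> (\<Sum>j\<in>UNIV. 2 * a t $ j - (?q (Suc t) $ j - ?q t $ j))"
    by (intro sum_mono)
  with l1 show "\<Delta> \<le> (\<Sum>j\<in>UNIV. 2 * a t $ j - (?q (Suc t) $ j - ?q t $ j))" by linarith
qed

section \<open>Real inequalities and time averages\<close>

lemma exp_le_quadratic:
  fixes x :: real
  assumes "\<bar>x\<bar> \<le> 1"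
  shows "exp x \<le> 1 + x + x\<^sup>2"
proof (cases "0 \<le> x")
  case True
  then show ?thesis using assms exp_bound[of x] by simp
next
  case False
  define y where "y = - x"
  have y: "0 < y" "y \<le> 1" using False assms by (auto simp: y_def)
  have "1 \<le> (1 - y + y\<^sup>2) * (1 + y)"
    using y by (simp add: algebra_simps power2_eq_square)
  also have "\<dots> \<le> (1 - y + y\<^sup>2) * exp y"
    using y exp_ge_add_one_self[of y] by (intro mult_left_mono) auto
  finally have "exp (- y) * 1 \<le> exp (- y) * ((1 - y + y\<^sup>2) * exp y)"
    by (intro mult_left_mono) auto
  also have "\<dots> = (1 - y + y\<^sup>2) * (exp (- y) * exp y)" by (simp add: mult_ac)
  also have "\<dots> = 1 - y + y\<^sup>2" by (simp flip: exp_add)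
  finally show ?thesis by (simp add: y_def)
qed

lemma increment_le_of_squares:
  fixes y z :: real
  assumes "0 < y" and "z\<^sup>2 \<le> y\<^sup>2 + 2 * x + b"
  shows "z - y \<le> (x + b / 2) / y"
proof -
  have "0 \<le> (z - y)\<^sup>2" by simp
  then have "(z - y) * y \<le> x + b / 2"
    using assms(2) by (simp add: power2_eq_square algebra_simps)
  then show ?thesis using assms(1) by (simp add: pos_le_divide_eq)
qed

text \<open>
  A step of an exponential Lyapunov function. Far out, the bound \<open>\<xi>\<close> on the increment enters to
  first order, so that a negative mean makes the function contract; near the centre, the function
  grows at most in proportion to the distance \<open>b\<close> moved.
\<close>

lemma exp_lyapunov_step:
  fixes y z w \<beta> b D \<xi> :: real
  assumes "0 \<le> w" "w * \<beta> \<le> 1" and zy: "\<bar>z - y\<bar> \<le> \<beta>" "\<bar>z - y\<bar> \<le> b"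
    and \<xi>: "D \<le> y \<Longrightarrow> z - y \<le> \<xi>"
  shows "exp (w * z) \<le> exp (w * y) + (if D \<le> y then exp (w * y) * (w * \<xi> + (w * \<beta>)\<^sup>2) else 0)
    + 2 * w * exp (w * D) * b"
proof -
  have b: "0 \<le> b" using zy by linarith
  define x where "x = w * (z - y)"
  have absx: "\<bar>x\<bar> \<le> w * \<beta>" "\<bar>x\<bar> \<le> w * b"
    using assms by (auto simp: x_def abs_mult intro!: mult_left_mono)
  then have "exp x \<le> 1 + x + x\<^sup>2" using assms by (intro exp_le_quadratic) linarith
  moreover have ez: "exp (w * z) = exp (w * y) * exp x"
    by (simp add: x_def algebra_simps flip: exp_add)
  ultimately have "exp (w * z) \<le> exp (w * y) * (1 + x + x\<^sup>2)" by simp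
  then have z: "exp (w * z) \<le> exp (w * y) + exp (w * y) * (x + x\<^sup>2)"
    by (simp add: algebra_simps)
  show ?thesis
  proof (cases "D \<le> y")
    case True
    have "x \<le> w * \<xi>" using \<xi>[OF True] assms(1) by (simp add: x_def mult_left_mono)
    moreover have "x\<^sup>2 \<le> (w * \<beta>)\<^sup>2" using absx by (intro abs_le_square_iff[THEN iffD1]) auto
    ultimately have "exp (w * y) * (x + x\<^sup>2) \<le> exp (w * y) * (w * \<xi> + (w * \<beta>)\<^sup>2)"
      by (intro mult_left_mono) auto
    moreover have "0 \<le> 2 * w * exp (w * D) * b" using assms b by simp
    ultimately show ?thesis unfolding if_P[OF True] using z by linarith
  next
    case False
    have "x\<^sup>2 = \<bar>x\<bar> * \<bar>x\<bar>" by (simp add: power2_eq_square)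
    also have "\<dots> \<le> 1 * \<bar>x\<bar>" using absx assms by (intro mult_right_mono) auto
    finally have "x + x\<^sup>2 \<le> 2 * w * b" using absx by linarith
    then have "exp (w * y) * (x + x\<^sup>2) \<le> exp (w * y) * (2 * w * b)"
      by (intro mult_left_mono) auto
    also have "\<dots> \<le> exp (w * D) * (2 * w * b)"
      using False assms b by (intro mult_right_mono) (auto intro: mult_left_mono)
    finally show ?thesis using z False by (simp add: mult_ac)
  qed
qed

lemma sum_telescope_le:
  fixes \<Phi> g h :: "nat \<Rightarrow> real"
  assumes "\<And>t. \<Phi> (Suc t) + g t \<le> \<Phi> t + h t"
  shows "\<Phi> t + (\<Sum>\<tau><t. g \<tau>) \<le> \<Phi> 0 + (\<Sum>\<tau><t. h \<tau>)"
proof (induction t)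
  case (Suc t)
  then show ?case using assms[of t] by simp
qed simp

lemma limsup_ratio_le:
  fixes n g :: "nat \<Rightarrow> real"
  assumes g: "filterlim g at_top sequentially" and le: "\<And>t. n t \<le> c\<^sub>0 + c * g t"
  shows "limsup (\<lambda>t. ereal (n t / g t)) \<le> ereal c"
proof -
  have "(\<lambda>t. c\<^sub>0 / g t + c) \<longlonglongrightarrow> 0 + c"
    by (intro tendsto_intros real_tendsto_divide_at_top[OF tendsto_const g])
  then have lim: "(\<lambda>t. ereal (c\<^sub>0 / g t + c)) \<longlonglongrightarrow> ereal c" by simp
  have "eventually (\<lambda>t. 0 < g t) sequentially"
    using g by (simp add: filterlim_at_top_dense)
  then have "eventually (\<lambda>t. ereal (n t / g t) \<le> ereal (c\<^sub>0 / g t + c)) sequentially"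
  proof eventually_elim
    case (elim t)
    then show ?case using le[of t] by (simp add: field_simps)
  qed
  then have "limsup (\<lambda>t. ereal (n t / g t)) \<le> limsup (\<lambda>t. ereal (c\<^sub>0 / g t + c))"
    by (rule Limsup_mono)
  also have "\<dots> = ereal c" using lim by (intro lim_imp_Limsup) simp_all
  finally show ?thesis .
qed

lemma time_avg_le:
  assumes "\<And>t. (\<Sum>\<tau><t. h \<tau>) \<le> c\<^sub>0 + c * real t"
  shows "time_avg h \<le> ereal c"
  unfolding time_avg_def by (rule limsup_ratio_le[OF filterlim_real_sequentially assms])

lemma time_avg_linear_growth:
  assumes h: "\<And>t. 0 \<le> h t" and "0 < c" and growth: "eventually (\<lambda>t. c * real t \<le> h t) sequentially"
  shows "time_avg h = \<infinity>"
proof (rule ccontr)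
  assume "time_avg h \<noteq> \<infinity>"
  then have "time_avg h < \<infinity>" by simp
  then obtain R where "time_avg h < ereal R"
    using less_PInf_Ex_of_nat by auto
  then have "eventually (\<lambda>t. ereal ((\<Sum>\<tau><t. h \<tau>) / real t) < ereal R) sequentially"
    unfolding time_avg_def by (rule Limsup_lessD)
  then obtain n\<^sub>1 where n1: "\<And>t. n\<^sub>1 \<le> t \<Longrightarrow> (\<Sum>\<tau><t. h \<tau>) / real t < R"
    by (auto simp: eventually_sequentially)
  obtain n\<^sub>2 where n2: "\<And>t. n\<^sub>2 \<le> t \<Longrightarrow> c * real t \<le> h t"
    using growth by (auto simp: eventually_sequentially)
  obtain n\<^sub>3 :: nat where n3: "2 * R / c \<le> real n\<^sub>3" using real_arch_simple by blast
  define n where "n = Suc (n\<^sub>1 + n\<^sub>2 + n\<^sub>3)"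
  have "c * real n \<le> h \<tau>" if "\<tau> \<in> {n..<2 * n}" for \<tau>
  proof -
    have "c * real n \<le> c * real \<tau>" using that \<open>0 < c\<close> by simp
    also have "\<dots> \<le> h \<tau>" using that by (intro n2) (simp add: n_def)
    finally show ?thesis .
  qed
  then have "(\<Sum>\<tau>\<in>{n..<2 * n}. c * real n) \<le> (\<Sum>\<tau>\<in>{n..<2 * n}. h \<tau>)" by (intro sum_mono)
  also have "\<dots> \<le> (\<Sum>\<tau><2 * n. h \<tau>)" using h by (intro sum_mono2) auto
  also have "\<dots> < R * real (2 * n)"
    using n1[of "2 * n"] by (simp add: n_def pos_divide_less_eq)
  finally have "real n * (c * real n) < real n * (2 * R)" by (simp add: mult_ac)
  then have "c * real n < 2 * R" by (simp add: n_def)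
  moreover have "2 * R \<le> c * real n\<^sub>3" using n3 \<open>0 < c\<close> by (simp add: field_simps)
  moreover have "c * real n\<^sub>3 \<le> c * real n" using \<open>0 < c\<close> by (simp add: n_def)
  ultimately show False by linarith
qed

section \<open>The dual function\<close>

definition lagrangian where
  "lagrangian N V u s x = V * cost N s x + (\<Sum>j\<in>UNIV. u $ j * (arrival N s x $ j - service N s x $ j))"

definition state_dual where
  "state_dual N V u s = (INF x \<in> feasible N s. lagrangian N V u s x)"

context stochastic_network
begin

lemma state_prob_nonneg: "0 \<le> state_prob N s"
  using distr_S[of 0 s] by (metis measure_nonneg)

lemma borel_measurable_of_past:
  "f \<in> measurable (F t) R \<Longrightarrow> f \<in> measurable M R"
  using subalgebra_F by (rule measurable_from_subalg)

lemma measurable_state: "S t \<in> measurable M (count_space UNIV)"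
  using adapted_S by (rule borel_measurable_of_past)

lemma sum_state_prob: "(\<Sum>s\<in>UNIV. state_prob N s) = 1"
proof -
  note measurable_state[of 0, measurable]
  have "(\<Sum>s\<in>UNIV. state_prob N s) = (\<Sum>s\<in>UNIV. prob {\<omega> \<in> space M. S 0 \<omega> = s})"
    using distr_S by simp
  also have "\<dots> = prob (\<Union>s\<in>UNIV. {\<omega> \<in> space M. S 0 \<omega> = s})"
    by (intro finite_measure_finite_Union[symmetric]) (auto simp: disjoint_family_on_def)
  also have "(\<Union>s\<in>UNIV. {\<omega> \<in> space M. S 0 \<omega> = s}) = space M" by auto
  finally show ?thesis by (simp add: prob_space)
qed

lemma feasible_nonempty: "feasible N s \<noteq> {}"
proof -
  obtain y :: "'s \<Rightarrow> nat \<Rightarrow> 'x" where "\<forall>k\<in>{1..CARD('r) + 2}. y s k \<in> feasible N s"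
    using slackness by blast
  then have "y s 1 \<in> feasible N s" by simp
  then show ?thesis by blast
qed

lemma net_input_bound:
  "x \<in> feasible N s \<Longrightarrow> \<bar>arrival N s x $ j - service N s x $ j\<bar> \<le> \<delta>"
  using arrival_bound[of x s j] service_bound[of x s j] by linarith

lemma lagrangian_bound:
  assumes "x \<in> feasible N s"
  shows "\<bar>lagrangian N V u s x\<bar> \<le> \<bar>V\<bar> * \<delta> + (\<Sum>j\<in>UNIV. \<bar>u $ j\<bar>) * \<delta>"
proof -
  have "\<bar>\<Sum>j\<in>UNIV. u $ j * (arrival N s x $ j - service N s x $ j)\<bar> \<le> (\<Sum>j\<in>UNIV. \<bar>u $ j\<bar> * \<delta>)"
    using net_input_bound[OF assms]
    by (intro order.trans[OF sum_abs] sum_mono) (auto simp: abs_mult intro: mult_left_mono)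
  moreover have "\<bar>V * cost N s x\<bar> \<le> \<bar>V\<bar> * \<delta>"
    using cost_bound[OF assms] by (auto simp: abs_mult intro: mult_left_mono)
  ultimately show ?thesis by (simp add: lagrangian_def sum_distrib_right)
qed

lemma bdd_below_lagrangian: "bdd_below (lagrangian N V u s ` feasible N s)"
proof (rule bdd_belowI2)
  fix x assume "x \<in> feasible N s"
  then show "- (\<bar>V\<bar> * \<delta> + (\<Sum>j\<in>UNIV. \<bar>u $ j\<bar>) * \<delta>) \<le> lagrangian N V u s x"
    using lagrangian_bound[of x s V u] by linarith
qed

lemma state_dual_le: "x \<in> feasible N s \<Longrightarrow> state_dual N V u s \<le> lagrangian N V u s x"
  unfolding state_dual_def by (intro cINF_lower bdd_below_lagrangian)

lemma state_dual_qla_action: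
  assumes "qla_action N V u s x"
  shows "lagrangian N V u s x = state_dual N V u s"
proof (rule antisym)
  have neg: "lagrangian N V u s y = - (- V * cost N s y + (\<Sum>j\<in>UNIV. u $ j * (service N s y $ j - arrival N s y $ j)))" for y
    by (simp add: lagrangian_def right_diff_distrib sum_subtractf)
  have x: "x \<in> feasible N s" using assms by (simp add: qla_action_def is_arg_max_def)
  show "lagrangian N V u s x \<le> state_dual N V u s"
    unfolding state_dual_def using assms
    by (intro cINF_greatest feasible_nonempty) (auto simp: neg qla_action_def is_arg_max_linorder)
  show "state_dual N V u s \<le> lagrangian N V u s x" using x by (rule state_dual_le)
qed

lemma state_dual_lipschitz:
  "\<bar>state_dual N V u s - state_dual N V v s\<bar> \<le> \<delta> * CARD('r) * norm (u - v)"
proof -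
  have one_sided: "state_dual N V u s - \<delta> * CARD('r) * norm (u - v) \<le> state_dual N V v s" for u v
    unfolding state_dual_def[of N V v]
  proof (rule cINF_greatest[OF feasible_nonempty])
    fix x assume x: "x \<in> feasible N s"
    have "lagrangian N V u s x - lagrangian N V v s x
        = (\<Sum>j\<in>UNIV. (u - v) $ j * (arrival N s x $ j - service N s x $ j))"
      by (simp add: lagrangian_def left_diff_distrib sum_subtractf)
    also have "\<dots> \<le> (\<Sum>j\<in>(UNIV :: 'r set). norm (u - v) * \<delta>)"
    proof (rule sum_mono)
      fix j
      have "(u - v) $ j * (arrival N s x $ j - service N s x $ j)
          \<le> \<bar>(u - v) $ j\<bar> * \<bar>arrival N s x $ j - service N s x $ j\<bar>"
        by (metis abs_ge_self abs_mult)
      also have "\<dots> \<le> norm (u - v) * \<delta>"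
        using net_input_bound[OF x] component_le_norm_cart[of "u - v" j] by (intro mult_mono) auto
      finally show "(u - v) $ j * (arrival N s x $ j - service N s x $ j) \<le> norm (u - v) * \<delta>" .
    qed
    finally show "state_dual N V u s - \<delta> * CARD('r) * norm (u - v) \<le> lagrangian N V v s x"
      using state_dual_le[OF x, of V u] by (simp add: mult_ac)
  qed
  show ?thesis
    using one_sided[of u v] one_sided[of v u] by (simp add: abs_le_iff norm_minus_commute)
qed

lemma continuous_state_dual: "continuous_on UNIV (\<lambda>u. state_dual N V u s)"
proof (rule lipschitz_on_continuous_on)
  show "(\<delta> * CARD('r))-lipschitz_on UNIV (\<lambda>u. state_dual N V u s)"
    using state_dual_lipschitz delta_pos by (intro lipschitz_onI) (auto simp: dist_norm)
qed

lemma dual_altdef: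
  "dual N V u = (INF y \<in> {y. \<forall>s. y s \<in> feasible N s}. \<Sum>s\<in>UNIV. state_prob N s * lagrangian N V u s (y s))"
  by (simp add: dual_def lagrangian_def)

lemma sum_state_dual_le:
  assumes "\<And>s. y s \<in> feasible N s"
  shows "(\<Sum>s\<in>UNIV. state_prob N s * state_dual N V u s) \<le> (\<Sum>s\<in>UNIV. state_prob N s * lagrangian N V u s (y s))"
  using assms by (intro sum_mono mult_left_mono state_dual_le state_prob_nonneg)

text \<open>
  The minimization defining the dual function splits over the states, since the action for each
  state is chosen separately. This turns the dual function into the mean of what the
  greedy action achieves in a random state.
\<close>

lemma dual_eq_sum_state_dual:
  "dual N V u = (\<Sum>s\<in>UNIV. state_prob N s * state_dual N V u s)"
proof (rule antisym)
  let ?Y = "{y. \<forall>s. y s \<in> feasible N s}"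
  have "\<forall>s. \<exists>x. x \<in> feasible N s" using feasible_nonempty by blast
  then have nonempty: "?Y \<noteq> {}" by (auto dest: choice)
  show "(\<Sum>s\<in>UNIV. state_prob N s * state_dual N V u s) \<le> dual N V u"
    unfolding dual_altdef by (intro cINF_greatest nonempty sum_state_dual_le) simp
  have bdd: "bdd_below ((\<lambda>y. \<Sum>s\<in>UNIV. state_prob N s * lagrangian N V u s (y s)) ` ?Y)"
    using sum_state_dual_le by (intro bdd_belowI2) auto
  show "dual N V u \<le> (\<Sum>s\<in>UNIV. state_prob N s * state_dual N V u s)"
  proof (rule field_le_epsilon)
    fix e :: real assume "0 < e"
    have "\<exists>x\<in>feasible N s. lagrangian N V u s x < state_dual N V u s + e" for s
    proof -
      have "(INF x\<in>feasible N s. lagrangian N V u s x) < state_dual N V u s + e"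
        using \<open>0 < e\<close> by (simp flip: state_dual_def)
      then show ?thesis by (rule cINF_less_iff[OF feasible_nonempty bdd_below_lagrangian, THEN iffD1])
    qed
    then obtain y where y: "\<And>s. y s \<in> feasible N s" "\<And>s. lagrangian N V u s (y s) < state_dual N V u s + e"
      by metis
    have "dual N V u \<le> (\<Sum>s\<in>UNIV. state_prob N s * lagrangian N V u s (y s))"
      unfolding dual_altdef using y by (intro cINF_lower bdd) auto
    also have "\<dots> \<le> (\<Sum>s\<in>UNIV. state_prob N s * (state_dual N V u s + e))"
      using y by (intro sum_mono mult_left_mono state_prob_nonneg) (auto intro: less_imp_le)
    also have "\<dots> = (\<Sum>s\<in>UNIV. state_prob N s * state_dual N V u s) + e"
      by (simp add: distrib_left sum.distrib sum_state_prob flip: sum_distrib_right)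
    finally show "dual N V u \<le> (\<Sum>s\<in>UNIV. state_prob N s * state_dual N V u s) + e" .
  qed
qed

lemma state_dual_concave:
  assumes "0 \<le> \<kappa>" "\<kappa> \<le> 1"
  shows "(1 - \<kappa>) * state_dual N V u s + \<kappa> * state_dual N V v s
    \<le> state_dual N V ((1 - \<kappa>) *\<^sub>R u + \<kappa> *\<^sub>R v) s"
  unfolding state_dual_def[of N V "(1 - \<kappa>) *\<^sub>R u + \<kappa> *\<^sub>R v"]
proof (rule cINF_greatest[OF feasible_nonempty])
  fix x assume x: "x \<in> feasible N s"
  have "lagrangian N V ((1 - \<kappa>) *\<^sub>R u + \<kappa> *\<^sub>R v) s x
      = (1 - \<kappa>) * lagrangian N V u s x + \<kappa> * lagrangian N V v s x"
    by (simp add: lagrangian_def algebra_simps sum.distrib sum_subtractf sum_distrib_left)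
  then show "(1 - \<kappa>) * state_dual N V u s + \<kappa> * state_dual N V v s
      \<le> lagrangian N V ((1 - \<kappa>) *\<^sub>R u + \<kappa> *\<^sub>R v) s x"
    using assms x by (auto intro!: add_mono mult_left_mono state_dual_le)
qed

lemma dual_concave:
  assumes "0 \<le> \<kappa>" "\<kappa> \<le> 1"
  shows "(1 - \<kappa>) * dual N V u + \<kappa> * dual N V v \<le> dual N V ((1 - \<kappa>) *\<^sub>R u + \<kappa> *\<^sub>R v)"
proof -
  have "(1 - \<kappa>) * dual N V u + \<kappa> * dual N V v
      = (\<Sum>s\<in>UNIV. state_prob N s * ((1 - \<kappa>) * state_dual N V u s + \<kappa> * state_dual N V v s))"
    by (simp add: dual_eq_sum_state_dual algebra_simps sum.distrib sum_subtractf sum_distrib_left)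
  also have "\<dots> \<le> dual N V ((1 - \<kappa>) *\<^sub>R u + \<kappa> *\<^sub>R v)"
    unfolding dual_eq_sum_state_dual[of V "(1 - \<kappa>) *\<^sub>R u + \<kappa> *\<^sub>R v"]
    using assms by (intro sum_mono mult_left_mono state_dual_concave state_prob_nonneg) auto
  finally show ?thesis .
qed

lemma state_dual_scale_le:
  assumes "0 < a"
  shows "a * state_dual N V u s \<le> state_dual N (a * V) (a *\<^sub>R u) s"
  unfolding state_dual_def[of N "a * V"]
proof (rule cINF_greatest[OF feasible_nonempty])
  fix x assume x: "x \<in> feasible N s"
  have "lagrangian N (a * V) (a *\<^sub>R u) s x = a * lagrangian N V u s x"
    by (simp add: lagrangian_def distrib_left sum_distrib_left mult.assoc)
  then show "a * state_dual N V u s \<le> lagrangian N (a * V) (a *\<^sub>R u) s x"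
    using assms x by (simp add: state_dual_le)
qed

lemma dual_scale:
  assumes "0 < a"
  shows "dual N (a * V) (a *\<^sub>R u) = a * dual N V u"
proof -
  have "a * state_dual N V u s = state_dual N (a * V) (a *\<^sub>R u) s" for s
    using state_dual_scale_le[OF assms, of V u s] assms
      state_dual_scale_le[of "1 / a" "a * V" "a *\<^sub>R u" s] by (simp add: field_simps)
  then have "dual N (a * V) (a *\<^sub>R u) = (\<Sum>s\<in>UNIV. state_prob N s * (a * state_dual N V u s))"
    by (simp add: dual_eq_sum_state_dual)
  then show ?thesis
    by (simp add: dual_eq_sum_state_dual sum_distrib_left mult.left_commute)
qed

text \<open>
  By concavity, the drop from the maximizer to a far point is at least the drop to a near point on
  the same ray, scaled up by the ratio of the distances.
\<close>

lemma dual_global_slope: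
  assumes u0: "\<And>j. 0 \<le> u\<^sub>0 $ j" and poly: "locally_polyhedral (dual N V) u\<^sub>0 \<epsilon> L" and "0 < \<epsilon>"
    and u: "\<And>j. 0 \<le> u $ j"
  shows "dual N V u + L * norm (u - u\<^sub>0) \<le> dual N V u\<^sub>0"
proof (cases "norm (u - u\<^sub>0) < \<epsilon>")
  case True
  then show ?thesis using poly u by (simp add: locally_polyhedral_def norm_minus_commute)
next
  case False
  \<comment> \<open>Move from \<open>u\<^sub>0\<close> towards \<open>u\<close> until the distance is \<open>\<epsilon> / 2\<close>.\<close>
  define d where "d = norm (u - u\<^sub>0)"
  define \<kappa> where "\<kappa> = \<epsilon> / (2 * d)"
  have d: "\<epsilon> \<le> d" "0 < d" using False \<open>0 < \<epsilon>\<close> by (auto simp: d_def)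
  then have \<kappa>: "0 < \<kappa>" "\<kappa> \<le> 1" "\<kappa> * d = \<epsilon> / 2" using \<open>0 < \<epsilon>\<close> by (auto simp: \<kappa>_def field_simps)
  define v where "v = (1 - \<kappa>) *\<^sub>R u\<^sub>0 + \<kappa> *\<^sub>R u"
  have v: "v - u\<^sub>0 = \<kappa> *\<^sub>R (u - u\<^sub>0)" by (simp add: v_def algebra_simps)
  then have dist: "norm (v - u\<^sub>0) = \<epsilon> / 2" using \<kappa> by (simp add: d_def)
  have "\<forall>j. 0 \<le> v $ j" using u u0 \<kappa> by (simp add: v_def)
  then have "dual N V v + L * norm (u\<^sub>0 - v) \<le> dual N V u\<^sub>0"
    using poly dist \<open>0 < \<epsilon>\<close> by (simp add: locally_polyhedral_def)
  moreover have "norm (u\<^sub>0 - v) = \<kappa> * d" using dist \<kappa> by (simp add: norm_minus_commute)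
  moreover have "(1 - \<kappa>) * dual N V u\<^sub>0 + \<kappa> * dual N V u \<le> dual N V v"
    unfolding v_def using \<kappa> by (intro dual_concave) auto
  ultimately have "\<kappa> * (dual N V u + L * d) \<le> \<kappa> * dual N V u\<^sub>0" by (simp add: algebra_simps)
  then show ?thesis using \<kappa> by (simp add: d_def)
qed

lemma dual_max_is_arg_max:
  assumes "\<exists>!u. is_arg_max (dual N V) (\<lambda>u. \<forall>j. 0 \<le> u $ j) u"
  shows "is_arg_max (dual N V) (\<lambda>u. \<forall>j. 0 \<le> u $ j) (dual_max N V)"
  unfolding dual_max_def arg_max_def using assms by (rule someI_ex[OF ex1_implies_ex])

text \<open>
  The dual function is jointly homogeneous in \<open>V\<close> and the prices, so its maximizer and its maximum are
  proportional to \<open>V\<close>, while the slope \<open>L\<close> is the same for every \<open>V\<close>.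
\<close>

lemma dual_slope_scaled:
  assumes unique: "\<And>V. 1 \<le> V \<Longrightarrow> \<exists>!u. is_arg_max (dual N V) (\<lambda>u. \<forall>j. 0 \<le> u $ j) u"
    and poly: "locally_polyhedral (dual N 1) (dual_max N 1) \<epsilon> L" and "0 < \<epsilon>" "0 < L" and V: "1 \<le> V"
  shows "0 \<le> dual_max N V $ j"
    and "dual N V (dual_max N V) = V * dual N 1 (dual_max N 1)"
    and "(\<And>j. 0 \<le> u $ j) \<Longrightarrow> dual N V u + L * norm (u - dual_max N V) \<le> dual N V (dual_max N V)"
proof -
  let ?m = "dual_max N 1"
  have m: "\<And>j. 0 \<le> ?m $ j" using dual_max_is_arg_max[OF unique[OF order_refl]] by (simp add: is_arg_max_def)
  have slope: "dual N V u + L * norm (u - V *\<^sub>R ?m) \<le> dual N V (V *\<^sub>R ?m)" if u: "\<And>j. 0 \<le> u $ j" for u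
  proof -
    have "dual N 1 ((1 / V) *\<^sub>R u) + L * norm ((1 / V) *\<^sub>R u - ?m) \<le> dual N 1 ?m"
      using u V by (intro dual_global_slope[OF m poly \<open>0 < \<epsilon>\<close>]) simp
    then have "V * (dual N 1 ((1 / V) *\<^sub>R u) + L * norm ((1 / V) *\<^sub>R u - ?m)) \<le> V * dual N 1 ?m"
      using V by (intro mult_left_mono) auto
    moreover have "V * norm ((1 / V) *\<^sub>R u - ?m) = norm (u - V *\<^sub>R ?m)"
    proof -
      have "u - V *\<^sub>R ?m = V *\<^sub>R ((1 / V) *\<^sub>R u - ?m)" using V by (simp add: algebra_simps)
      then show ?thesis using V by (metis abs_of_nonneg norm_scaleR order.trans zero_le_one)
    qed
    then have "V * (L * norm ((1 / V) *\<^sub>R u - ?m)) = L * norm (u - V *\<^sub>R ?m)" by (simp add: mult.left_commute)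
    ultimately show ?thesis
      using dual_scale[of V 1 "(1 / V) *\<^sub>R u"] dual_scale[of V 1 ?m] V by (simp add: distrib_left)
  qed
  have "is_arg_max (dual N V) (\<lambda>u. \<forall>j. 0 \<le> u $ j) (V *\<^sub>R ?m)"
    unfolding is_arg_max_linorder
  proof (intro conjI allI impI)
    fix u :: "real ^ 'r" assume "\<forall>j. 0 \<le> u $ j"
    then have "dual N V u + L * norm (u - V *\<^sub>R ?m) \<le> dual N V (V *\<^sub>R ?m)" using slope by blast
    moreover have "0 \<le> L * norm (u - V *\<^sub>R ?m)" using \<open>0 < L\<close> by simp
    ultimately show "dual N V u \<le> dual N V (V *\<^sub>R ?m)" by linarith
  qed (use m V in simp)
  then have eq: "dual_max N V = V *\<^sub>R ?m"
    using unique[OF V] dual_max_is_arg_max[OF unique[OF V]] by blast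
  show "0 \<le> dual_max N V $ j" using eq m V by simp
  show "dual N V (dual_max N V) = V * dual N 1 ?m" using eq dual_scale[of V 1 ?m] V by simp
  show "(\<And>j. 0 \<le> u $ j) \<Longrightarrow> dual N V u + L * norm (u - dual_max N V) \<le> dual N V (dual_max N V)"
    using eq slope by simp
qed

end

section \<open>Averaging over the fresh network state\<close>

lemma Int_stable_vimage: "Int_stable {f -` A \<inter> \<Omega> |A. A \<in> sets R}"
  unfolding Int_stable_def
proof safe
  fix A B assume "A \<in> sets R" "B \<in> sets R"
  then show "\<exists>C. f -` A \<inter> \<Omega> \<inter> (f -` B \<inter> \<Omega>) = f -` C \<inter> \<Omega> \<and> C \<in> sets R"
    by (intro exI[of _ "A \<inter> B"]) auto
qed

context stochastic_network
begin

text \<open>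
  What is known before the state of slot \<open>t\<close> is drawn. In slot \<open>0\<close> this is nothing at
  all.
\<close>

definition past :: "nat \<Rightarrow> 'w measure" where
  "past t = (case t of 0 \<Rightarrow> sigma (space M) {} | Suc k \<Rightarrow> F k)"

lemma space_F: "space (F t) = space M"
  using subalgebra_F by (simp add: subalgebra_def)

lemma space_past: "space (past t) = space M"
  by (simp add: past_def space_F split: nat.split)

lemma sets_past_0: "sets (past 0) = {{}, space M}"
  by (simp add: past_def sigma_sets_empty_eq)

lemma subalgebra_past: "subalgebra M (past t)" and subalgebra_F_past: "subalgebra (F t) (past t)"
proof -
  show "subalgebra (F t) (past t)"
  proof (cases t)
    case 0
    have "{} \<in> sets (F 0)" "space M \<in> sets (F 0)" using sets.top[of "F 0"] by (auto simp: space_F)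
    then show ?thesis using 0 by (auto simp: subalgebra_def space_past space_F sets_past_0)
  next
    case (Suc k)
    then show ?thesis using mono_F[of k t] by (simp add: subalgebra_def past_def space_F)
  qed
  then show "subalgebra M (past t)" using subalgebra_F[of t] by (auto simp: subalgebra_def)
qed

lemma indep_state_of_past: "indep_set (sets (past t)) {S t -` B \<inter> space M | B. True}"
proof (cases t)
  case 0
  have "S 0 -` B \<inter> space M \<in> events" for B
    using measurable_state by (auto intro: measurable_sets)
  then show ?thesis
    unfolding 0 sets_past_0 by (intro indep_setI) (auto simp: prob_space Int_absorb1)
next
  case (Suc k)
  then show ?thesis using indep_past[of k] by (simp add: past_def)
qed

lemma expectation_times_state_indicator:
  fixes \<phi> :: "'w \<Rightarrow> real"
  assumes \<phi>: "\<phi> \<in> borel_measurable (past t)" and int: "integrable M \<phi>"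
  shows "integrable M (\<lambda>\<omega>. \<phi> \<omega> * indicator {s} (S t \<omega>))"
    and "expectation (\<lambda>\<omega>. \<phi> \<omega> * indicator {s} (S t \<omega>)) = expectation \<phi> * state_prob N s"
proof -
  define I where "I \<omega> = (indicator {s} (S t \<omega>) :: real)" for \<omega>
  have I: "I \<in> borel_measurable M"
    unfolding I_def by (rule measurable_compose[OF measurable_state]) simp
  have past: "\<phi> -` A \<inter> space M \<in> sets (past t)" if "A \<in> sets borel" for A
    using measurable_sets[OF \<phi> that] by (simp add: space_past)
  have state: "\<exists>B. I -` A \<inter> space M = S t -` B \<inter> space M" for A
    by (intro exI[of _ "{s'. (indicator {s} s' :: real) \<in> A}"]) (auto simp: I_def)
  have indep: "indep_var borel \<phi> borel I"
    unfolding indep_var_eq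
  proof (intro conjI indep_set_sigma_sets)
    show "\<phi> \<in> borel_measurable M" using \<phi> by (rule measurable_from_subalg[OF subalgebra_past])
    show "I \<in> borel_measurable M" by (rule I)
    show "indep_set {\<phi> -` A \<inter> space M |A. A \<in> sets borel} {I -` A \<inter> space M |A. A \<in> sets borel}"
    proof (rule indep_setI)
      fix a b
      assume "a \<in> {\<phi> -` A \<inter> space M |A. A \<in> sets borel}"
        and "b \<in> {I -` A \<inter> space M |A. A \<in> sets borel}"
      then have "a \<in> sets (past t)" "b \<in> {S t -` B \<inter> space M |B. True}"
        using past state by auto
      then show "prob (a \<inter> b) = prob a * prob b" by (rule indep_setD[OF indep_state_of_past])
    next
      show "{\<phi> -` A \<inter> space M |A. A \<in> sets borel} \<subseteq> events"
        using past subalgebra_past[of t] unfolding subalgebra_def by blast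
      show "{I -` A \<inter> space M |A. A \<in> sets borel} \<subseteq> events"
        using measurable_sets[OF I] by blast
    qed
  qed (rule Int_stable_vimage)+
  have ind: "integrable M I"
    using I by (intro integrable_const_bound[where B = 1]) (auto simp: I_def indicator_def)
  show "integrable M (\<lambda>\<omega>. \<phi> \<omega> * indicator {s} (S t \<omega>))"
    using indep_var_integrable[OF indep int ind] by (simp add: I_def)
  have "expectation (\<lambda>\<omega>. indicator {s} (S t \<omega>)) = expectation (indicator {\<omega>\<in>space M. S t \<omega> = s})"
    by (intro Bochner_Integration.integral_cong) (auto simp: indicator_def)
  also have "\<dots> = state_prob N s"
    using distr_S by (simp add: Int_def conj_commute)
  finally show "expectation (\<lambda>\<omega>. \<phi> \<omega> * indicator {s} (S t \<omega>)) = expectation \<phi> * state_prob N s"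
    using indep_var_lebesgue_integral[OF indep int ind] by (simp add: I_def[abs_def])
qed

text \<open>
  The state of a slot is independent of the past, so in expectations it may be replaced by its mean.
  This is the only way in which randomness enters the proof; conditional expectations are avoided
  because every function of the state is a finite sum of indicators.
\<close>

lemma expectation_fresh_state:
  fixes h :: "'s \<Rightarrow> 'w \<Rightarrow> real"
  assumes h: "\<And>s. h s \<in> borel_measurable (past t)" and int: "\<And>s. integrable M (h s)"
  shows "integrable M (\<lambda>\<omega>. h (S t \<omega>) \<omega>)"
    and "expectation (\<lambda>\<omega>. h (S t \<omega>) \<omega>) = expectation (\<lambda>\<omega>. \<Sum>s\<in>UNIV. state_prob N s * h s \<omega>)"
proof -
  have eq: "h (S t \<omega>) \<omega> = (\<Sum>s\<in>UNIV. h s \<omega> * indicator {s} (S t \<omega>))" for \<omega>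
    by (simp add: indicator_def sum.delta' if_distrib cong: if_cong)
  show "integrable M (\<lambda>\<omega>. h (S t \<omega>) \<omega>)"
    unfolding eq by (intro Bochner_Integration.integrable_sum expectation_times_state_indicator h int)
  have "expectation (\<lambda>\<omega>. h (S t \<omega>) \<omega>)
      = (\<Sum>s\<in>UNIV. expectation (\<lambda>\<omega>. h s \<omega> * indicator {s} (S t \<omega>)))"
    unfolding eq by (rule Bochner_Integration.integral_sum) (rule expectation_times_state_indicator[OF h int])
  also have "\<dots> = (\<Sum>s\<in>UNIV. expectation (h s) * state_prob N s)"
    by (simp only: expectation_times_state_indicator(2)[OF h int])
  also have "\<dots> = expectation (\<lambda>\<omega>. \<Sum>s\<in>UNIV. state_prob N s * h s \<omega>)"
    using int by (simp add: Bochner_Integration.integral_sum mult.commute)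
  finally show "expectation (\<lambda>\<omega>. h (S t \<omega>) \<omega>) = expectation (\<lambda>\<omega>. \<Sum>s\<in>UNIV. state_prob N s * h s \<omega>)" .
qed

end

section \<open>Backlogs under a causal policy\<close>

lemma borel_measurable_component:
  fixes f :: "'a \<Rightarrow> real ^ 'n"
  shows "f \<in> borel_measurable R \<Longrightarrow> (\<lambda>\<omega>. f \<omega> $ j) \<in> borel_measurable R"
  by (rule measurable_compose[OF _ borel_measurable_continuous_onI]) (auto intro: continuous_intros)

locale controlled_network = stochastic_network M F S N \<delta>
  for M :: "'w measure" and F and S :: "nat \<Rightarrow> 'w \<Rightarrow> 's::finite"
    and N :: "('s, 'x::topological_space, 'r::finite) network" and \<delta> :: real +
  fixes x :: "nat \<Rightarrow> 'w \<Rightarrow> 'x" and w :: "real ^ 'r"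
  assumes policy: "policy N F S x" and initial_nonneg: "0 \<le> w $ j"
begin

definition W :: "nat \<Rightarrow> 'w \<Rightarrow> real ^ 'r" where
  "W t \<omega> = queue w (\<lambda>\<tau>. services N S x \<tau> \<omega>) (\<lambda>\<tau>. arrivals N S x \<tau> \<omega>) t"

lemma action_feasible: "\<omega> \<in> space M \<Longrightarrow> x t \<omega> \<in> feasible N (S t \<omega>)"
  using policy by (simp add: policy_def space_F)

lemma arrivals_bound: "\<omega> \<in> space M \<Longrightarrow> 0 \<le> arrivals N S x t \<omega> $ j \<and> arrivals N S x t \<omega> $ j \<le> \<delta>"
  unfolding arrivals_def by (rule arrival_bound[OF action_feasible])

lemma services_bound: "\<omega> \<in> space M \<Longrightarrow> 0 \<le> services N S x t \<omega> $ j \<and> services N S x t \<omega> $ j \<le> \<delta>"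
  unfolding services_def by (rule service_bound[OF action_feasible])

lemma W_nonneg: "\<omega> \<in> space M \<Longrightarrow> 0 \<le> W t \<omega> $ j"
  unfolding W_def using arrivals_bound by (intro queue_nonneg initial_nonneg) blast

lemma W_0: "W 0 \<omega> = w"
  by (simp add: W_def)

lemma W_bound:
  assumes "\<omega> \<in> space M"
  shows "norm (W t \<omega>) \<le> (\<Sum>j\<in>UNIV. w $ j + real t * \<delta>)"
proof -
  have "norm (W t \<omega>) \<le> (\<Sum>j\<in>UNIV. \<bar>W t \<omega> $ j\<bar>)" by (rule norm_le_l1_cart)
  also have "\<dots> \<le> (\<Sum>j\<in>UNIV. w $ j + real t * \<delta>)"
  proof (rule sum_mono)
    fix j
    have "W t \<omega> $ j \<le> w $ j + real t * \<delta>"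
      unfolding W_def using assms arrivals_bound services_bound
      by (intro queue_le_initial_plus initial_nonneg) blast+
    then show "\<bar>W t \<omega> $ j\<bar> \<le> w $ j + real t * \<delta>" using W_nonneg[OF assms] by simp
  qed
  finally show ?thesis .
qed

lemma measurable_costs: "costs N S x t \<in> borel_measurable M"
  and measurable_arrivals: "(\<lambda>\<omega>. arrivals N S x t \<omega> $ j) \<in> borel_measurable M"
  and measurable_services: "(\<lambda>\<omega>. services N S x t \<omega> $ j) \<in> borel_measurable M"
  using policy by (auto simp: policy_def intro: borel_measurable_of_past borel_measurable_component[OF borel_measurable_of_past])

lemma W_component_measurable: "(\<lambda>\<omega>. W t \<omega> $ j) \<in> borel_measurable (past t)"
proof (induction t arbitrary: j)
  case 0
  then show ?case by (simp add: W_0)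
next
  case (Suc t)
  have [measurable]: "(\<lambda>\<omega>. W t \<omega> $ j) \<in> borel_measurable (F t)"
    using Suc by (rule measurable_from_subalg[OF subalgebra_F_past])
  have [measurable]: "(\<lambda>\<omega>. arrivals N S x t \<omega> $ j) \<in> borel_measurable (F t)"
    "(\<lambda>\<omega>. services N S x t \<omega> $ j) \<in> borel_measurable (F t)"
    using policy by (auto simp: policy_def intro: borel_measurable_component)
  have "(\<lambda>\<omega>. max (W t \<omega> $ j - services N S x t \<omega> $ j) 0 + arrivals N S x t \<omega> $ j) \<in> borel_measurable (F t)"
    by measurable
  then show ?case by (simp add: W_def past_def)
qed

lemma W_measurable: "W t \<in> borel_measurable (past t)"
  using W_component_measurable
  by (subst borel_measurable_euclidean_space) (auto simp: Basis_vec_def inner_axis)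

lemma far_continuous_measurable:
  fixes g :: "real ^ 'r \<Rightarrow> real"
  assumes "continuous_on UNIV g"
  shows "(\<lambda>\<omega>. if D \<le> norm (W t \<omega> - c) then g (W t \<omega>) else 0) \<in> borel_measurable (past t)"
proof -
  note W_measurable[measurable] and borel_measurable_continuous_onI[OF assms, measurable]
  show ?thesis by measurable
qed

lemma far_continuous_integrable:
  fixes g :: "real ^ 'r \<Rightarrow> real"
  assumes "continuous_on UNIV g"
  shows "integrable M (\<lambda>\<omega>. if D \<le> norm (W t \<omega> - c) then g (W t \<omega>) else 0)"
proof -
  let ?R = "\<Sum>j\<in>UNIV. w $ j + real t * \<delta>"
  have "compact (g ` cball 0 ?R)"
    using assms by (intro compact_continuous_image compact_cball) (auto intro: continuous_on_subset)
  then obtain B where "\<forall>y\<in>g ` cball 0 ?R. norm y \<le> B"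
    using compact_imp_bounded bounded_iff by metis
  then have B: "\<bar>g u\<bar> \<le> B" if "norm u \<le> ?R" for u using that by auto
  have "0 \<le> B" using order.trans[OF abs_ge_zero B[of 0]] initial_nonneg delta_pos
    by (simp add: sum_nonneg)
  then show ?thesis
    using B W_bound far_continuous_measurable[OF assms]
    by (intro integrable_const_bound[where B = B] measurable_from_subalg[OF subalgebra_past]) auto
qed

lemma continuous_integrable:
  fixes g :: "real ^ 'r \<Rightarrow> real"
  assumes "continuous_on UNIV g"
  shows "integrable M (\<lambda>\<omega>. g (W t \<omega>))"
  using far_continuous_integrable[OF assms, of 0] by simp

lemma continuous_measurable:
  fixes g :: "real ^ 'r \<Rightarrow> real"
  assumes "continuous_on UNIV g"
  shows "(\<lambda>\<omega>. g (W t \<omega>)) \<in> borel_measurable (past t)"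
  using far_continuous_measurable[OF assms, of 0] by simp

lemma integrable_W: "integrable M (\<lambda>\<omega>. W t \<omega> $ j)"
  by (rule continuous_integrable) (intro continuous_intros)

lemma integrable_costs: "integrable M (costs N S x t)"
  using measurable_costs cost_bound[OF action_feasible]
  by (intro integrable_const_bound[where B = \<delta>]) (auto simp: costs_def)

lemma integrable_arrivals: "integrable M (\<lambda>\<omega>. arrivals N S x t \<omega> $ j)"
  using measurable_arrivals arrivals_bound
  by (intro integrable_const_bound[where B = \<delta>]) auto

lemma integrable_services: "integrable M (\<lambda>\<omega>. services N S x t \<omega> $ j)"
  using measurable_services services_bound
  by (intro integrable_const_bound[where B = \<delta>]) auto

lemma expected_generated_le: "expected_generated M N S x t \<le> CARD('r) * \<delta> * real t"
proof -
  have "expectation (\<lambda>\<omega>. arrivals N S x \<tau> \<omega> $ j) \<le> \<delta>" for \<tau> j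
    using arrivals_bound by (intro integral_le_const integrable_arrivals) auto
  then have "expected_generated M N S x t \<le> (\<Sum>\<tau><t. \<Sum>j\<in>(UNIV::'r set). \<delta>)"
    unfolding expected_generated_def by (intro sum_mono)
  then show ?thesis by (simp add: mult_ac)
qed

lemma lagrangian_action:
  "lagrangian N V u (S t \<omega>) (x t \<omega>) = V * costs N S x t \<omega>
    + (\<Sum>j\<in>UNIV. u $ j * (arrivals N S x t \<omega> $ j - services N S x t \<omega> $ j))"
  by (simp add: lagrangian_def costs_def arrivals_def services_def)

end

text \<open>
  Weak duality: in each slot the expected cost plus the priced net input is at least the dual value.
  The priced net input accumulates to at most the priced backlog, which for a stable
  policy must be sublinear along some subsequence of slots.
\<close>

lemma (in stochastic_network) dual_le_avg_cost_stable:
  assumes x: "policy N F S x" and stable: "stable M N S x" and u: "\<And>j. 0 \<le> u $ j"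
  shows "ereal (dual N 1 u) \<le> avg_cost M N S x"
proof (rule ccontr)
  interpret controlled_network M F S N \<delta> x 0 by unfold_locales (simp_all add: x)
  have backlog: "backlog N S x = W" by (intro ext) (simp add: backlog_def W_def)
  let ?q = "dual N 1 u"
  define P where "P = 1 + (\<Sum>j\<in>UNIV. u $ j)"
  have P: "0 < P" "u $ j \<le> P" for j
    using u member_le_sum[of j UNIV "\<lambda>j. u $ j"] by (simp_all add: P_def add_pos_nonneg sum_nonneg)
  define h where "h t = (\<Sum>j\<in>UNIV. expectation (\<lambda>\<omega>. W t \<omega> $ j))" for t
  define net where "net t j = expectation (\<lambda>\<omega>. arrivals N S x t \<omega> $ j - services N S x t \<omega> $ j)" for t j
  have slot: "?q \<le> expectation (costs N S x t) + (\<Sum>j\<in>UNIV. u $ j * net t j)" for t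
  proof -
    have int: "integrable M (\<lambda>\<omega>. \<Sum>j\<in>UNIV. u $ j * (arrivals N S x t \<omega> $ j - services N S x t \<omega> $ j))"
      using integrable_arrivals integrable_services by (intro Bochner_Integration.integrable_sum) auto
    have "?q = expectation (\<lambda>\<omega>. state_dual N 1 u (S t \<omega>))"
      by (subst expectation_fresh_state(2)) (simp_all add: dual_eq_sum_state_dual prob_space)
    also have "\<dots> \<le> expectation (\<lambda>\<omega>. lagrangian N 1 u (S t \<omega>) (x t \<omega>))"
    proof (rule integral_mono)
      show "integrable M (\<lambda>\<omega>. state_dual N 1 u (S t \<omega>))"
        by (rule expectation_fresh_state(1)) simp_all
      show "integrable M (\<lambda>\<omega>. lagrangian N 1 u (S t \<omega>) (x t \<omega>))"
        unfolding lagrangian_action using int integrable_costs by simp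
    qed (rule state_dual_le[OF action_feasible])
    also have "\<dots> = expectation (costs N S x t)
        + expectation (\<lambda>\<omega>. \<Sum>j\<in>UNIV. u $ j * (arrivals N S x t \<omega> $ j - services N S x t \<omega> $ j))"
      unfolding lagrangian_action using int integrable_costs by simp
    also have "expectation (\<lambda>\<omega>. \<Sum>j\<in>UNIV. u $ j * (arrivals N S x t \<omega> $ j - services N S x t \<omega> $ j))
        = (\<Sum>j\<in>UNIV. u $ j * net t j)"
      unfolding net_def using integrable_arrivals integrable_services
      by (subst Bochner_Integration.integral_sum) simp_all
    finally show ?thesis .
  qed
  have priced: "(\<Sum>j\<in>UNIV. u $ j * (\<Sum>\<tau><t. net \<tau> j)) \<le> P * h t" for t
  proof -
    have W: "0 \<le> expectation (\<lambda>\<omega>. W t \<omega> $ j)" for j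
      using W_nonneg by (intro integral_nonneg_AE) auto
    have "(\<Sum>\<tau><t. net \<tau> j) \<le> expectation (\<lambda>\<omega>. W t \<omega> $ j)" for j
    proof -
      have "(\<Sum>\<tau><t. net \<tau> j) = expectation (\<lambda>\<omega>. \<Sum>\<tau><t. arrivals N S x \<tau> \<omega> $ j - services N S x \<tau> \<omega> $ j)"
        using integrable_arrivals integrable_services by (simp add: net_def)
      also have "\<dots> \<le> expectation (\<lambda>\<omega>. W t \<omega> $ j)"
        using integrable_arrivals integrable_services integrable_W
        by (intro integral_mono) (auto simp: W_def intro!: sum_net_input_le_queue)
      finally show ?thesis .
    qed
    then have "(\<Sum>j\<in>UNIV. u $ j * (\<Sum>\<tau><t. net \<tau> j)) \<le> (\<Sum>j\<in>UNIV. P * expectation (\<lambda>\<omega>. W t \<omega> $ j))"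
      using u W P by (intro sum_mono order.trans[OF mult_left_mono mult_right_mono]) auto
    then show ?thesis by (simp add: h_def sum_distrib_left)
  qed
  have total: "?q * real t \<le> (\<Sum>\<tau><t. expectation (costs N S x \<tau>)) + P * h t" for t
  proof -
    have "?q * real t \<le> (\<Sum>\<tau><t. expectation (costs N S x \<tau>) + (\<Sum>j\<in>UNIV. u $ j * net \<tau> j))"
      using sum_mono[of "{..<t}" "\<lambda>_. ?q", OF slot] by (simp add: mult.commute)
    also have "\<dots> = (\<Sum>\<tau><t. expectation (costs N S x \<tau>)) + (\<Sum>j\<in>UNIV. u $ j * (\<Sum>\<tau><t. net \<tau> j))"
      by (simp add: sum.distrib sum_distrib_left sum.swap[of _ "{..<t}" UNIV])
    finally show ?thesis using priced[of t] by linarith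
  qed
  assume "\<not> ereal ?q \<le> avg_cost M N S x"
  then have "avg_cost M N S x < ereal ?q" by simp
  then obtain c where c: "avg_cost M N S x < ereal c" "c < ?q"
    by (metis ereal_dense2 less_ereal.simps(1))
  then have "eventually (\<lambda>t. ereal ((\<Sum>\<tau><t. expectation (costs N S x \<tau>)) / real t) < ereal c) sequentially"
    unfolding avg_cost_def time_avg_def by (intro Limsup_lessD)
  then have "eventually (\<lambda>t. (?q - c) / P * real t \<le> h t) sequentially"
    using eventually_gt_at_top[of 0]
  proof eventually_elim
    case (elim t)
    then have "(\<Sum>\<tau><t. expectation (costs N S x \<tau>)) < c * real t" by (simp add: pos_divide_less_eq)
    then have "(?q - c) * real t \<le> P * h t" using total[of t] by (simp add: algebra_simps)
    then show ?case using P(1) by (simp add: field_simps)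
  qed
  moreover have "0 \<le> h t" for t
    unfolding h_def using W_nonneg by (intro sum_nonneg integral_nonneg_AE) auto
  ultimately have "time_avg h = \<infinity>" using c(2) P(1) by (intro time_avg_linear_growth[where c = "(?q - c) / P"]) auto
  moreover have "time_avg h < \<infinity>"
    using stable unfolding stable_def avg_backlog_def backlog h_def .
  ultimately show False by simp
qed

section \<open>Drift under the greedy action\<close>

text \<open>
  The backlog \<open>W\<close> doubles as the price vector for which the action in each slot minimizes the
  Lagrangian. The initial backlog is arbitrary, so that it can be placed near the dual maximizer.
\<close>

locale greedy_network = controlled_network M F S N \<delta> x w
  for M :: "'w measure" and F and S :: "nat \<Rightarrow> 'w \<Rightarrow> 's::finite"
    and N :: "('s, 'x::topological_space, 'r::finite) network" and \<delta> :: real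
    and x :: "nat \<Rightarrow> 'w \<Rightarrow> 'x" and w :: "real ^ 'r" +
  fixes V :: real
  assumes greedy: "\<omega> \<in> space M \<Longrightarrow> qla_action N V (W t \<omega>) (S t \<omega>) (x t \<omega>)"
begin

text \<open>
  The action is a minimizer for the price vector \<open>W t\<close> and merely feasible for the price vector
  \<open>c\<close>, so its net input is a supergradient at \<open>W t\<close> of the dual function of the current state.
\<close>

lemma net_input_le_state_dual_diff:
  assumes "\<omega> \<in> space M"
  shows "(\<Sum>j\<in>UNIV. (W t \<omega> $ j - c $ j) * (arrivals N S x t \<omega> $ j - services N S x t \<omega> $ j))
    \<le> state_dual N V (W t \<omega>) (S t \<omega>) - state_dual N V c (S t \<omega>)"
proof -
  have "(\<Sum>j\<in>UNIV. (W t \<omega> $ j - c $ j) * (arrivals N S x t \<omega> $ j - services N S x t \<omega> $ j))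
      = lagrangian N V (W t \<omega>) (S t \<omega>) (x t \<omega>) - lagrangian N V c (S t \<omega>) (x t \<omega>)"
    by (simp add: lagrangian_action left_diff_distrib sum_subtractf)
  then show ?thesis
    using state_dual_qla_action[OF greedy[OF assms]] state_dual_le[OF action_feasible[OF assms]]
    by (metis diff_mono order_refl)
qed

lemma W_step_norm:
  assumes "\<omega> \<in> space M" "\<And>j. 0 \<le> c $ j"
  shows "(norm (W (Suc t) \<omega> - c))\<^sup>2 \<le> (norm (W t \<omega> - c))\<^sup>2
    + 2 * (\<Sum>j\<in>UNIV. (W t \<omega> $ j - c $ j) * (arrivals N S x t \<omega> $ j - services N S x t \<omega> $ j))
    + 3 * real CARD('r) * \<delta>\<^sup>2"
  unfolding W_def using assms arrivals_bound services_bound W_nonneg[unfolded W_def]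
  by (intro queue_step_norm) blast+

lemma W_step_dist:
  fixes c :: "real ^ 'r"
  assumes "\<omega> \<in> space M"
  shows "\<bar>norm (W (Suc t) \<omega> - c) - norm (W t \<omega> - c)\<bar> \<le> CARD('r) * \<delta>"
    and "\<bar>norm (W (Suc t) \<omega> - c) - norm (W t \<omega> - c)\<bar>
      \<le> (\<Sum>j\<in>UNIV. 2 * arrivals N S x t \<omega> $ j - (W (Suc t) \<omega> $ j - W t \<omega> $ j))"
  unfolding W_def using assms arrivals_bound services_bound W_nonneg[unfolded W_def]
  by (intro queue_step_diff; blast)+

text \<open>
  The drift-plus-penalty argument: with the quadratic Lyapunov function, the weighted cost plus the
  drift of the backlog has mean at most the dual value at the current backlog, up to a constant.
\<close>

lemma avg_cost_le:
  assumes dual: "\<And>u. (\<And>j. 0 \<le> u $ j) \<Longrightarrow> dual N V u \<le> V * q" and V: "0 < V"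
  shows "avg_cost M N S x \<le> ereal (q + 3 * real CARD('r) * \<delta>\<^sup>2 / (2 * V))"
  unfolding avg_cost_def
proof (rule time_avg_le)
  fix t
  let ?B = "3 * real CARD('r) * \<delta>\<^sup>2"
  let ?\<Phi> = "\<lambda>t. expectation (\<lambda>\<omega>. (norm (W t \<omega>))\<^sup>2)"
  have int: "integrable M (\<lambda>\<omega>. (norm (W t \<omega>))\<^sup>2)" for t
    by (rule continuous_integrable) (intro continuous_intros)
  have "?\<Phi> (Suc t) + 2 * V * expectation (costs N S x t) \<le> ?\<Phi> t + (2 * (V * q) + ?B)" for t
  proof -
    let ?m = "\<lambda>\<omega>. state_dual N V (W t \<omega>) (S t \<omega>)"
    have fresh: "integrable M ?m"
        "expectation ?m = expectation (\<lambda>\<omega>. \<Sum>s\<in>UNIV. state_prob N s * state_dual N V (W t \<omega>) s)"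
      by (rule expectation_fresh_state[of "\<lambda>s \<omega>. state_dual N V (W t \<omega>) s", OF
            continuous_measurable[OF continuous_state_dual] continuous_integrable[OF continuous_state_dual]])+
    have "(norm (W (Suc t) \<omega>))\<^sup>2 + 2 * V * costs N S x t \<omega> \<le> (norm (W t \<omega>))\<^sup>2 + 2 * ?m \<omega> + ?B"
      if \<omega>: "\<omega> \<in> space M" for \<omega>
      using W_step_norm[OF \<omega>, of 0 t] state_dual_qla_action[OF greedy[OF \<omega>], of t]
      by (simp add: lagrangian_action distrib_left)
    then have "expectation (\<lambda>\<omega>. (norm (W (Suc t) \<omega>))\<^sup>2 + 2 * V * costs N S x t \<omega>)
        \<le> expectation (\<lambda>\<omega>. (norm (W t \<omega>))\<^sup>2 + 2 * ?m \<omega> + ?B)"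
      using int integrable_costs fresh(1) by (intro integral_mono) auto
    then have "?\<Phi> (Suc t) + 2 * V * expectation (costs N S x t) \<le> ?\<Phi> t + 2 * expectation ?m + ?B"
      using int integrable_costs fresh(1) by (simp add: prob_space)
    moreover have "expectation ?m \<le> V * q"
      unfolding fresh(2)
    proof (rule integral_le_const)
      show "integrable M (\<lambda>\<omega>. \<Sum>s\<in>UNIV. state_prob N s * state_dual N V (W t \<omega>) s)"
        by (intro continuous_integrable continuous_intros continuous_state_dual)
      show "AE \<omega> in M. (\<Sum>s\<in>UNIV. state_prob N s * state_dual N V (W t \<omega>) s) \<le> V * q"
        using dual W_nonneg by (auto simp flip: dual_eq_sum_state_dual)
    qed
    ultimately show ?thesis by linarith
  qed
  from sum_telescope_le[of ?\<Phi>, OF this, of t]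
  have "?\<Phi> t + 2 * V * (\<Sum>\<tau><t. expectation (costs N S x \<tau>)) \<le> ?\<Phi> 0 + real t * (2 * (V * q) + ?B)"
    by (simp add: sum_distrib_left)
  moreover have "0 \<le> ?\<Phi> t" by simp
  ultimately have "2 * V * (\<Sum>\<tau><t. expectation (costs N S x \<tau>)) \<le> ?\<Phi> 0 + real t * (2 * (V * q) + ?B)"
    by linarith
  then show "(\<Sum>\<tau><t. expectation (costs N S x \<tau>)) \<le> ?\<Phi> 0 / (2 * V) + (q + ?B / (2 * V)) * real t"
    using V by (simp add: field_simps)
qed

end

text \<open>
  The dual function has its maximum at \<open>c\<close> and drops from there with slope at least \<open>L\<close>. Outside
  radius \<open>D\<close> around \<open>c\<close> this slope outweighs the constant in the quadratic drift bound, and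
  \<open>\<eta>\<close> is small enough for the exponential Lyapunov function to be expanded to first order.
\<close>

locale attracted_network = greedy_network M F S N \<delta> x w V
  for M :: "'w measure" and F and S :: "nat \<Rightarrow> 'w \<Rightarrow> 's::finite"
    and N :: "('s, 'x::topological_space, 'r::finite) network" and \<delta> :: real
    and x :: "nat \<Rightarrow> 'w \<Rightarrow> 'x" and w :: "real ^ 'r" and V :: real +
  fixes c :: "real ^ 'r" and L D \<eta> :: real
  assumes centre_nonneg: "0 \<le> c $ j"
    and slope: "(\<And>j. 0 \<le> u $ j) \<Longrightarrow> dual N V u + L * norm (u - c) \<le> dual N V c"
    and radius: "0 < D" "3 * real CARD('r) * \<delta>\<^sup>2 \<le> L * D"
    and rate: "0 < \<eta>" "\<eta> * (CARD('r) * \<delta>) \<le> 1" "\<eta> * (CARD('r) * \<delta>)\<^sup>2 \<le> L / 4"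
begin

lemma slope_pos: "0 < L"
proof -
  have "0 < \<eta> * (CARD('r) * \<delta>)\<^sup>2" using rate(1) delta_pos by simp
  with rate(3) show ?thesis by linarith
qed

definition far_moment :: "nat \<Rightarrow> real" where
  "far_moment t = expectation (\<lambda>\<omega>. if D \<le> norm (W t \<omega> - c) then exp (\<eta> * norm (W t \<omega> - c)) else 0)"

lemma integrable_far_moment:
  "integrable M (\<lambda>\<omega>. if D \<le> norm (W t \<omega> - c) then exp (\<eta> * norm (W t \<omega> - c)) else 0)"
  by (rule far_continuous_integrable) (intro continuous_intros)

text \<open>
  Exponential concentration of the virtual backlog around \<open>c\<close>. Beyond radius \<open>D\<close> the distance to
  \<open>c\<close> has drift at most \<open>- L / 2\<close>, so \<open>exp (\<eta> * distance)\<close> contracts there. Inside radius \<open>D\<close> it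
  grows at most in proportion to the movement of the queues, that is, to the arrivals up to a
  telescoping sum of backlogs. Thus the exponential moment spent beyond radius \<open>D\<close> is bounded
  by the number of packets generated, not just by the number of slots elapsed.
\<close>

lemma sum_far_moment_le_generated:
  "\<eta> * L / 4 * (\<Sum>\<tau><t. far_moment \<tau>)
    \<le> exp (\<eta> * norm (w - c)) + 2 * \<eta> * exp (\<eta> * D) * (\<Sum>j\<in>UNIV. w $ j)
      + 4 * \<eta> * exp (\<eta> * D) * expected_generated M N S x t"
proof -
  let ?B = "3 * real CARD('r) * \<delta>\<^sup>2" and ?K = "2 * \<eta> * exp (\<eta> * D)" and ?\<beta> = "CARD('r) * \<delta>"
  define Y where "Y t \<omega> = norm (W t \<omega> - c)" for t \<omega>
  define \<Phi> where "\<Phi> t = expectation (\<lambda>\<omega>. exp (\<eta> * Y t \<omega>)) + ?K * (\<Sum>j\<in>UNIV. expectation (\<lambda>\<omega>. W t \<omega> $ j))" for t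
  define A where "A t = (\<Sum>j\<in>UNIV. expectation (\<lambda>\<omega>. arrivals N S x t \<omega> $ j))" for t
  \<comment> \<open>The maximum with \<open>D\<close> changes nothing beyond radius \<open>D\<close> and makes \<open>g\<close> continuous.\<close>
  define g where "g s u = exp (\<eta> * norm (u - c)) *
    (\<eta> * ((state_dual N V u s - state_dual N V c s + ?B / 2) / max D (norm (u - c))) + (\<eta> * ?\<beta>)\<^sup>2)" for s u
  define h where "h s t \<omega> = (if D \<le> Y t \<omega> then g s (W t \<omega>) else 0)" for s t \<omega>
  have max_pos: "max D r \<noteq> 0" for r using radius(1) by (simp add: max_def)
  have cont_g: "continuous_on UNIV (g s)" for s
    unfolding g_def by (intro continuous_intros continuous_state_dual) (simp add: max_pos)
  have cont_exp: "continuous_on UNIV (\<lambda>u. exp (\<eta> * norm (u - c)))"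
    by (intro continuous_intros)
  have int_exp: "integrable M (\<lambda>\<omega>. exp (\<eta> * Y t \<omega>))" for t
    unfolding Y_def using cont_exp by (rule continuous_integrable)
  have int_T: "integrable M (\<lambda>\<omega>. if D \<le> Y t \<omega> then exp (\<eta> * Y t \<omega>) else 0)" for t
    unfolding Y_def by (rule integrable_far_moment)
  have fresh: "integrable M (\<lambda>\<omega>. h (S t \<omega>) t \<omega>)"
      "expectation (\<lambda>\<omega>. h (S t \<omega>) t \<omega>) = expectation (\<lambda>\<omega>. \<Sum>s\<in>UNIV. state_prob N s * h s t \<omega>)" for t
    using expectation_fresh_state[of "\<lambda>s. h s t" t]
      far_continuous_measurable[OF cont_g] far_continuous_integrable[OF cont_g]
    unfolding h_def Y_def by blast+
  have int_h: "integrable M (h s t)" for s t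
    unfolding h_def Y_def by (rule far_continuous_integrable[OF cont_g])
  have mean: "(\<Sum>s\<in>UNIV. state_prob N s * h s t \<omega>)
      \<le> - (\<eta> * L / 4) * (if D \<le> Y t \<omega> then exp (\<eta> * Y t \<omega>) else 0)" if \<omega>: "\<omega> \<in> space M" for t \<omega>
  proof (cases "D \<le> Y t \<omega>")
    case True
    let ?e = "exp (\<eta> * Y t \<omega>)" and ?Y = "Y t \<omega>"
    have Y: "0 < ?Y" using True radius(1) by linarith
    have "(\<Sum>s\<in>UNIV. state_prob N s * h s t \<omega>) = (\<Sum>s\<in>UNIV. ?e * \<eta> / ?Y * (state_prob N s * state_dual N V (W t \<omega>) s)
        - ?e * \<eta> / ?Y * (state_prob N s * state_dual N V c s)
        + (?e * \<eta> / ?Y * (?B / 2) + ?e * (\<eta> * ?\<beta>)\<^sup>2) * state_prob N s)"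
      using True Y unfolding h_def g_def Y_def[symmetric]
      by (intro sum.cong refl) (simp add: field_simps)
    also have "\<dots> = ?e * \<eta> / ?Y * dual N V (W t \<omega>) - ?e * \<eta> / ?Y * dual N V c
        + (?e * \<eta> / ?Y * (?B / 2) + ?e * (\<eta> * ?\<beta>)\<^sup>2)"
      by (simp only: sum.distrib sum_subtractf sum_distrib_left[symmetric] dual_eq_sum_state_dual
          sum_state_prob mult_1_right)
    also have "\<dots> = ?e * \<eta> * ((dual N V (W t \<omega>) - dual N V c + ?B / 2) / ?Y + \<eta> * ?\<beta>\<^sup>2)"
      using Y by (simp add: field_simps power2_eq_square)
    also have "\<dots> \<le> ?e * \<eta> * (- L / 2 + L / 4)"
    proof -
      have "0 \<le> L * D" using radius(2) by (rule order.trans[rotated]) simp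
      then have "0 \<le> L" using radius(1) by (simp add: zero_le_mult_iff)
      then have "?B \<le> L * ?Y" using radius(2) True by (meson mult_left_mono order.trans)
      then have "dual N V (W t \<omega>) - dual N V c + ?B / 2 \<le> (- L / 2) * ?Y"
        using slope[of "W t \<omega>"] W_nonneg[OF \<omega>] by (simp add: Y_def)
      then have "(dual N V (W t \<omega>) - dual N V c + ?B / 2) / ?Y \<le> - L / 2"
        using Y by (simp only: pos_divide_le_eq)
      then show ?thesis using rate by (intro mult_left_mono add_mono) auto
    qed
    finally show ?thesis using True by (simp add: field_simps)
  next
    case False
    then show ?thesis by (simp add: h_def)
  qed
  have step: "\<Phi> (Suc t) + \<eta> * L / 4 * far_moment t \<le> \<Phi> t + 2 * ?K * A t" for t
  proof -
    let ?move = "\<lambda>\<omega>. \<Sum>j\<in>UNIV. 2 * arrivals N S x t \<omega> $ j - (W (Suc t) \<omega> $ j - W t \<omega> $ j)"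
    have int_move: "integrable M ?move"
      using integrable_arrivals integrable_W by (intro Bochner_Integration.integrable_sum) simp
    have pointwise: "exp (\<eta> * Y (Suc t) \<omega>) \<le> exp (\<eta> * Y t \<omega>) + h (S t \<omega>) t \<omega> + ?K * ?move \<omega>"
      if \<omega>: "\<omega> \<in> space M" for \<omega>
    proof -
      let ?\<xi> = "(state_dual N V (W t \<omega>) (S t \<omega>) - state_dual N V c (S t \<omega>) + ?B / 2) / max D (Y t \<omega>)"
      have "exp (\<eta> * Y (Suc t) \<omega>) \<le> exp (\<eta> * Y t \<omega>)
          + (if D \<le> Y t \<omega> then exp (\<eta> * Y t \<omega>) * (\<eta> * ?\<xi> + (\<eta> * ?\<beta>)\<^sup>2) else 0) + ?K * ?move \<omega>"
      proof (rule exp_lyapunov_step)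
        show "\<bar>Y (Suc t) \<omega> - Y t \<omega>\<bar> \<le> ?\<beta>" "\<bar>Y (Suc t) \<omega> - Y t \<omega>\<bar> \<le> ?move \<omega>"
          unfolding Y_def using W_step_dist[OF \<omega>] by blast+
        assume far: "D \<le> Y t \<omega>"
        have "(Y (Suc t) \<omega>)\<^sup>2 \<le> (Y t \<omega>)\<^sup>2
            + 2 * (state_dual N V (W t \<omega>) (S t \<omega>) - state_dual N V c (S t \<omega>)) + ?B"
          unfolding Y_def
          by (intro order.trans[OF W_step_norm[OF \<omega> centre_nonneg]] add_mono mult_left_mono
              net_input_le_state_dual_diff[OF \<omega>]) simp_all
        then show "Y (Suc t) \<omega> - Y t \<omega> \<le> ?\<xi>"
          using far radius(1) increment_le_of_squares[of "Y t \<omega>"] by simp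
      qed (use rate in auto)
      then show ?thesis by (simp only: h_def g_def Y_def)
    qed
    have "expectation (\<lambda>\<omega>. exp (\<eta> * Y (Suc t) \<omega>))
        \<le> expectation (\<lambda>\<omega>. exp (\<eta> * Y t \<omega>) + h (S t \<omega>) t \<omega> + ?K * ?move \<omega>)"
      using int_exp fresh(1) int_move pointwise by (intro integral_mono) auto
    also have "\<dots> = expectation (\<lambda>\<omega>. exp (\<eta> * Y t \<omega>)) + expectation (\<lambda>\<omega>. h (S t \<omega>) t \<omega>) + ?K * expectation ?move"
      using int_exp fresh(1) int_move by simp
    also have "expectation ?move = 2 * A t - ((\<Sum>j\<in>UNIV. expectation (\<lambda>\<omega>. W (Suc t) \<omega> $ j))
        - (\<Sum>j\<in>UNIV. expectation (\<lambda>\<omega>. W t \<omega> $ j)))"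
      unfolding A_def using integrable_arrivals integrable_W
      by (subst Bochner_Integration.integral_sum) (simp_all add: sum_subtractf sum_distrib_left)
    finally have "expectation (\<lambda>\<omega>. exp (\<eta> * Y (Suc t) \<omega>))
        \<le> expectation (\<lambda>\<omega>. exp (\<eta> * Y t \<omega>)) + expectation (\<lambda>\<omega>. h (S t \<omega>) t \<omega>)
          + ?K * (2 * A t - ((\<Sum>j\<in>UNIV. expectation (\<lambda>\<omega>. W (Suc t) \<omega> $ j))
            - (\<Sum>j\<in>UNIV. expectation (\<lambda>\<omega>. W t \<omega> $ j))))" .
    moreover have "expectation (\<lambda>\<omega>. h (S t \<omega>) t \<omega>) \<le> - (\<eta> * L / 4) * far_moment t"
    proof -
      have "expectation (\<lambda>\<omega>. h (S t \<omega>) t \<omega>)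
          \<le> expectation (\<lambda>\<omega>. - (\<eta> * L / 4) * (if D \<le> Y t \<omega> then exp (\<eta> * Y t \<omega>) else 0))"
        unfolding fresh(2) using int_h int_T mean
        by (intro integral_mono Bochner_Integration.integrable_sum integrable_mult_right) auto
      also have "\<dots> = - (\<eta> * L / 4) * far_moment t" unfolding far_moment_def Y_def by (rule integral_mult_right_zero)
      finally show ?thesis .
    qed
    ultimately show ?thesis unfolding \<Phi>_def by (simp add: algebra_simps)
  qed
  have "\<Phi> t + (\<Sum>\<tau><t. \<eta> * L / 4 * far_moment \<tau>) \<le> \<Phi> 0 + (\<Sum>\<tau><t. 2 * ?K * A \<tau>)"
    using step by (rule sum_telescope_le)
  moreover have "0 \<le> \<Phi> t"
    unfolding \<Phi>_def using W_nonneg rate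
    by (intro add_nonneg_nonneg mult_nonneg_nonneg sum_nonneg integral_nonneg_AE) auto
  ultimately have "\<eta> * L / 4 * (\<Sum>\<tau><t. far_moment \<tau>) \<le> \<Phi> 0 + 2 * ?K * expected_generated M N S x t"
    by (simp add: expected_generated_def A_def sum_distrib_left)
  then show ?thesis by (simp add: Y_def \<Phi>_def W_0 prob_space mult.assoc)
qed

lemma sum_far_moment_le_time:
  "(\<Sum>\<tau><t. far_moment \<tau>)
    \<le> (exp (\<eta> * norm (w - c)) + 2 * \<eta> * exp (\<eta> * D) * (\<Sum>j\<in>UNIV. w $ j)) / (\<eta> * L / 4)
      + 16 * exp (\<eta> * D) * (CARD('r) * \<delta>) / L * real t"
proof -
  have "4 * \<eta> * exp (\<eta> * D) * expected_generated M N S x t \<le> 4 * \<eta> * exp (\<eta> * D) * (CARD('r) * \<delta> * real t)"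
    using rate by (intro mult_left_mono expected_generated_le) simp
  with sum_far_moment_le_generated[of t]
  have "\<eta> * L / 4 * (\<Sum>\<tau><t. far_moment \<tau>)
    \<le> exp (\<eta> * norm (w - c)) + 2 * \<eta> * exp (\<eta> * D) * (\<Sum>j\<in>UNIV. w $ j)
      + 4 * \<eta> * exp (\<eta> * D) * (CARD('r) * \<delta> * real t)" by linarith
  then show ?thesis using rate(1) slope_pos by (simp add: field_simps)
qed

text \<open>
  A bound on the long-run mean distance from \<open>c\<close> that depends neither on \<open>V\<close> nor on the initial
  backlog.
\<close>

definition mean_distance_bound :: real where
  "mean_distance_bound = exp (\<eta> * D) / \<eta> * (1 + 16 * (CARD('r) * \<delta>) / L)"

lemma integrable_distance: "integrable M (\<lambda>\<omega>. norm (W t \<omega> - c))"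
  by (rule continuous_integrable) (intro continuous_intros)

lemma sum_distance_le:
  "\<exists>C. \<forall>t. (\<Sum>\<tau><t. expectation (\<lambda>\<omega>. norm (W \<tau> \<omega> - c))) \<le> C + mean_distance_bound * real t"
proof -
  define C where "C = (exp (\<eta> * norm (w - c)) + 2 * \<eta> * exp (\<eta> * D) * (\<Sum>j\<in>UNIV. w $ j)) / (\<eta> * L / 4)"
  have "\<eta> * expectation (\<lambda>\<omega>. norm (W \<tau> \<omega> - c)) \<le> exp (\<eta> * D) + far_moment \<tau>" for \<tau>
  proof -
    let ?Y = "\<lambda>\<omega>. norm (W \<tau> \<omega> - c)"
    have "\<eta> * ?Y \<omega> \<le> exp (\<eta> * D) + (if D \<le> ?Y \<omega> then exp (\<eta> * ?Y \<omega>) else 0)" for \<omega>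
    proof (cases "D \<le> ?Y \<omega>")
      case True
      have "0 < exp (\<eta> * D)" by simp
      then show ?thesis
        unfolding if_P[OF True] using exp_ge_add_one_self[of "\<eta> * ?Y \<omega>"] by linarith
    next
      case False
      then have "\<eta> * ?Y \<omega> \<le> \<eta> * D" using rate(1) by simp
      then show ?thesis
        unfolding if_not_P[OF False] using exp_ge_add_one_self[of "\<eta> * D"] by linarith
    qed
    then have "expectation (\<lambda>\<omega>. \<eta> * ?Y \<omega>)
        \<le> expectation (\<lambda>\<omega>. exp (\<eta> * D) + (if D \<le> ?Y \<omega> then exp (\<eta> * ?Y \<omega>) else 0))"
      using integrable_distance integrable_far_moment by (intro integral_mono) auto
    then show ?thesis using integrable_far_moment[of \<tau>] by (simp add: far_moment_def prob_space)
  qed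
  then have "\<eta> * (\<Sum>\<tau><t. expectation (\<lambda>\<omega>. norm (W \<tau> \<omega> - c))) \<le> (\<Sum>\<tau><t. exp (\<eta> * D) + far_moment \<tau>)" for t
    unfolding sum_distrib_left by (intro sum_mono)
  also have "(\<Sum>\<tau><t. exp (\<eta> * D) + far_moment \<tau>)
      \<le> C + (exp (\<eta> * D) + 16 * exp (\<eta> * D) * (CARD('r) * \<delta>) / L) * real t" for t
  proof -
    have "(\<Sum>\<tau><t. exp (\<eta> * D) + far_moment \<tau>) = exp (\<eta> * D) * real t + (\<Sum>\<tau><t. far_moment \<tau>)"
      by (simp add: sum.distrib)
    then show ?thesis
      using sum_far_moment_le_time[of t] unfolding C_def distrib_right by linarith
  qed
  finally have "\<eta> * (\<Sum>\<tau><t. expectation (\<lambda>\<omega>. norm (W \<tau> \<omega> - c)))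
      \<le> C + (exp (\<eta> * D) + 16 * exp (\<eta> * D) * (CARD('r) * \<delta>) / L) * real t" for t .
  then have "(\<Sum>\<tau><t. expectation (\<lambda>\<omega>. norm (W \<tau> \<omega> - c)))
      \<le> (C + (exp (\<eta> * D) + 16 * exp (\<eta> * D) * (CARD('r) * \<delta>) / L) * real t) / \<eta>" for t
    using rate(1) by (simp add: pos_le_divide_eq mult.commute)
  also have "(C + (exp (\<eta> * D) + 16 * exp (\<eta> * D) * (CARD('r) * \<delta>) / L) * real t) / \<eta>
      = C / \<eta> + mean_distance_bound * real t" for t
    by (simp add: mean_distance_bound_def add_divide_distrib distrib_left distrib_right mult_ac)
  finally show ?thesis by blast
qed

lemma avg_backlog_le:
  fixes Q :: "nat \<Rightarrow> 'w \<Rightarrow> real ^ 'r"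
  assumes Q: "\<And>t \<omega> j. \<omega> \<in> space M \<Longrightarrow> Q t \<omega> $ j \<le> b + norm (W t \<omega> - c)" and "0 \<le> b"
  shows "avg_backlog M Q \<le> ereal (CARD('r) * (b + mean_distance_bound))"
proof -
  obtain C where C: "\<And>t. (\<Sum>\<tau><t. expectation (\<lambda>\<omega>. norm (W \<tau> \<omega> - c))) \<le> C + mean_distance_bound * real t"
    using sum_distance_le by blast
  show ?thesis
    unfolding avg_backlog_def
  proof (rule time_avg_le)
    fix t
    have "expectation (\<lambda>\<omega>. Q \<tau> \<omega> $ j) \<le> b + expectation (\<lambda>\<omega>. norm (W \<tau> \<omega> - c))" for \<tau> j
    proof -
      have "expectation (\<lambda>\<omega>. Q \<tau> \<omega> $ j) \<le> expectation (\<lambda>\<omega>. b + norm (W \<tau> \<omega> - c))"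
        using Q \<open>0 \<le> b\<close> integrable_distance by (intro integral_mono') auto
      then show ?thesis using integrable_distance by (simp add: prob_space)
    qed
    then have "(\<Sum>\<tau><t. \<Sum>j\<in>UNIV. expectation (\<lambda>\<omega>. Q \<tau> \<omega> $ j))
        \<le> (\<Sum>\<tau><t. \<Sum>j\<in>(UNIV::'r set). b + expectation (\<lambda>\<omega>. norm (W \<tau> \<omega> - c)))"
      by (intro sum_mono)
    also have "\<dots> = CARD('r) * (b * real t + (\<Sum>\<tau><t. expectation (\<lambda>\<omega>. norm (W \<tau> \<omega> - c))))"
      by (simp add: sum.distrib algebra_simps flip: sum_distrib_left)
    also have "\<dots> \<le> CARD('r) * (b * real t + (C + mean_distance_bound * real t))"
      using C by (intro mult_left_mono add_left_mono) auto
    also have "\<dots> = CARD('r) * C + CARD('r) * (b + mean_distance_bound) * real t"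
      by (simp add: algebra_simps)
    finally show "(\<Sum>\<tau><t. \<Sum>j\<in>UNIV. expectation (\<lambda>\<omega>. Q \<tau> \<omega> $ j))
        \<le> CARD('r) * C + CARD('r) * (b + mean_distance_bound) * real t" .
  qed
qed

text \<open>
  Without packet dropping and from empty queues, the same actions keep the backlog below the virtual
  one. So the policy itself competes in the infimum that defines the optimal cost.
\<close>

lemma policy_stable: "stable M N S x"
proof -
  define b where "b = (\<Sum>j\<in>UNIV. c $ j)"
  have b: "c $ j \<le> b" for j
    unfolding b_def using centre_nonneg by (intro member_le_sum) auto
  have "avg_backlog M (backlog N S x) \<le> ereal (CARD('r) * (b + mean_distance_bound))"
  proof (rule avg_backlog_le)
    fix t \<omega> j assume "\<omega> \<in> space M"
    have "backlog N S x t \<omega> $ j \<le> W t \<omega> $ j"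
      unfolding backlog_def W_def using initial_nonneg by (intro queue_mono_initial) simp
    also have "\<dots> \<le> c $ j + norm (W t \<omega> - c)"
      using component_le_norm_cart[of "W t \<omega> - c" j] by simp
    finally show "backlog N S x t \<omega> $ j \<le> b + norm (W t \<omega> - c)" using b[of j] by linarith
  qed (simp add: b_def sum_nonneg centre_nonneg)
  then show ?thesis unfolding stable_def by (rule order.strict_trans1) simp
qed

end

section \<open>FQLA-Ideal\<close>

locale fqla_network =
  attracted_network M F S N \<delta> x "fqla_offset N V" V "dual_max N V" L D \<eta>
  for M :: "'w measure" and F and S :: "nat \<Rightarrow> 'w \<Rightarrow> 's::finite"
    and N :: "('s, 'x::topological_space, 'r::finite) network" and \<delta> :: real
    and x :: "nat \<Rightarrow> 'w \<Rightarrow> 'x" and V L D \<eta> :: real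
begin

lemma fqla_virtual_eq: "fqla_virtual N S V x = W"
  by (intro ext) (simp add: fqla_virtual_def W_def)

lemma fqla_backlog_le:
  assumes "\<omega> \<in> space M"
  shows "fqla_backlog N S V x t \<omega> $ j \<le> (ln V)\<^sup>2 + \<delta> + norm (W t \<omega> - dual_max N V)"
proof -
  have "fqla_backlog N S V x t \<omega> $ j \<le> max (W t \<omega> $ j - fqla_offset N V $ j) 0 + \<delta>"
    unfolding fqla_backlog_def W_def
    using arrivals_bound[OF assms] services_bound[OF assms] initial_nonneg
    by (intro admitted_queue_le_virtual_excess) (simp_all add: fqla_admitted_def fqla_virtual_def)
  moreover have "W t \<omega> $ j - fqla_offset N V $ j \<le> (ln V)\<^sup>2 + norm (W t \<omega> - dual_max N V)"
    using component_le_norm_cart[of "W t \<omega> - dual_max N V" j] by (simp add: fqla_offset_def)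
  moreover have "0 \<le> (ln V)\<^sup>2 + norm (W t \<omega> - dual_max N V)" by simp
  ultimately show ?thesis by linarith
qed

lemma fqla_avg_backlog_le:
  "avg_backlog M (fqla_backlog N S V x) \<le> ereal (CARD('r) * ((ln V)\<^sup>2 + \<delta> + mean_distance_bound))"
  using fqla_backlog_le delta_pos by (intro avg_backlog_le) auto

text \<open>
  A packet is dropped only while its virtual queue is below its initial value, hence more than
  \<open>(ln V)\<^sup>2\<close> below the maximizer; Markov's inequality for the exponential moment applies.
\<close>

lemma expected_dropped_le:
  assumes V: "D \<le> (ln V)\<^sup>2"
  shows "expected_dropped M N S V x t \<le> CARD('r) * \<delta> * exp (- \<eta> * (ln V)\<^sup>2) * (\<Sum>\<tau><t. far_moment \<tau>)"
proof -
  let ?b = "(ln V)\<^sup>2"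
  have "expectation (\<lambda>\<omega>. arrivals N S x \<tau> \<omega> $ j - fqla_admitted N S V x \<tau> \<omega> $ j)
      \<le> \<delta> * exp (- \<eta> * ?b) * far_moment \<tau>" for \<tau> j
  proof -
    let ?Y = "\<lambda>\<omega>. norm (W \<tau> \<omega> - dual_max N V)"
    let ?Z = "\<lambda>\<omega>. if D \<le> ?Y \<omega> then exp (\<eta> * ?Y \<omega>) else 0"
    have nonneg: "0 \<le> \<delta> * exp (- \<eta> * ?b) * ?Z \<omega>" for \<omega> using delta_pos by simp
    have "arrivals N S x \<tau> \<omega> $ j - fqla_admitted N S V x \<tau> \<omega> $ j \<le> \<delta> * exp (- \<eta> * ?b) * ?Z \<omega>"
      if \<omega>: "\<omega> \<in> space M" for \<omega>
    proof (cases "W \<tau> \<omega> $ j \<ge> fqla_offset N V $ j")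
      case True
      then show ?thesis using nonneg[of \<omega>] by (simp add: fqla_admitted_def fqla_virtual_eq)
    next
      case False
      then have "?b < dual_max N V $ j - W \<tau> \<omega> $ j"
        using W_nonneg[OF \<omega>, of \<tau> j] by (simp add: fqla_offset_def max_def split: if_splits)
      then have far: "?b \<le> ?Y \<omega>"
        using component_le_norm_cart[of "W \<tau> \<omega> - dual_max N V" j] by simp
      have "arrivals N S x \<tau> \<omega> $ j - fqla_admitted N S V x \<tau> \<omega> $ j \<le> arrivals N S x \<tau> \<omega> $ j"
        using False by (simp add: fqla_admitted_def fqla_virtual_eq)
      also have "\<dots> \<le> \<delta> * 1" using arrivals_bound[OF \<omega>] by simp
      also have "\<dots> \<le> \<delta> * (exp (- \<eta> * ?b) * exp (\<eta> * ?Y \<omega>))"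
      proof (rule mult_left_mono)
        have "\<eta> * ?b \<le> \<eta> * ?Y \<omega>" using far rate(1) by simp
        then show "1 \<le> exp (- \<eta> * ?b) * exp (\<eta> * ?Y \<omega>)" by (simp flip: exp_add)
      qed (use delta_pos in simp)
      finally show ?thesis using far V by simp
    qed
    then have "expectation (\<lambda>\<omega>. arrivals N S x \<tau> \<omega> $ j - fqla_admitted N S V x \<tau> \<omega> $ j)
        \<le> expectation (\<lambda>\<omega>. \<delta> * exp (- \<eta> * ?b) * ?Z \<omega>)"
      using integrable_far_moment nonneg by (intro integral_mono' integrable_mult_right) auto
    then show ?thesis by (simp only: far_moment_def integral_mult_right_zero)
  qed
  then have "expected_dropped M N S V x t
      \<le> (\<Sum>\<tau><t. \<Sum>j\<in>(UNIV::'r set). \<delta> * exp (- \<eta> * ?b) * far_moment \<tau>)"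
    unfolding expected_dropped_def by (intro sum_mono)
  then show ?thesis by (simp add: sum_distrib_left mult.assoc)
qed

lemma drop_fraction_le:
  assumes V: "D \<le> (ln V)\<^sup>2" and generated: "filterlim (expected_generated M N S x) at_top sequentially"
  shows "drop_fraction M N S V x \<le> ereal (16 * (CARD('r) * \<delta>) * exp (\<eta> * D) / L * exp (- \<eta> * (ln V)\<^sup>2))"
  unfolding drop_fraction_def
proof (rule limsup_ratio_le[OF generated])
  fix t
  let ?a = "CARD('r) * \<delta> * exp (- \<eta> * (ln V)\<^sup>2)"
  let ?c = "exp (\<eta> * norm (fqla_offset N V - dual_max N V)) + 2 * \<eta> * exp (\<eta> * D) * (\<Sum>j\<in>UNIV. fqla_offset N V $ j)"
  have "(\<Sum>\<tau><t. far_moment \<tau>) \<le> (?c + 4 * \<eta> * exp (\<eta> * D) * expected_generated M N S x t) / (\<eta> * L / 4)"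
    using sum_far_moment_le_generated[of t] rate(1) slope_pos
    by (simp only: pos_le_divide_eq mult_pos_pos divide_pos_pos zero_less_numeral mult.commute)
  then have "?a * (\<Sum>\<tau><t. far_moment \<tau>)
      \<le> ?a * ((?c + 4 * \<eta> * exp (\<eta> * D) * expected_generated M N S x t) / (\<eta> * L / 4))"
    using delta_pos by (intro mult_left_mono) auto
  with expected_dropped_le[OF V, of t]
  have "expected_dropped M N S V x t
      \<le> ?a * ((?c + 4 * \<eta> * exp (\<eta> * D) * expected_generated M N S x t) / (\<eta> * L / 4))"
    by linarith
  also have "\<dots> = ?a * ?c / (\<eta> * L / 4)
      + 16 * (CARD('r) * \<delta>) * exp (\<eta> * D) / L * exp (- \<eta> * (ln V)\<^sup>2) * expected_generated M N S x t"
    using rate(1) slope_pos by (simp add: field_simps)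
  finally show "expected_dropped M N S V x t \<le> ?a * ?c / (\<eta> * L / 4)
      + 16 * (CARD('r) * \<delta>) * exp (\<eta> * D) / L * exp (- \<eta> * (ln V)\<^sup>2) * expected_generated M N S x t" .
qed

end

theorem theorem5:
  fixes M :: "'w measure"
    and F :: "nat \<Rightarrow> 'w measure"
    and S :: "nat \<Rightarrow> 'w \<Rightarrow> 's::finite"
    and N :: "('s, 'x::topological_space, 'r::finite) network"
    and \<delta> \<epsilon> L :: real
    and x_qla x_fqla :: "real \<Rightarrow> nat \<Rightarrow> 'w \<Rightarrow> 'x"
  assumes model: "stochastic_network M F S N \<delta>"
    and unique_maximizer:
      "\<And>V. V \<ge> 1 \<Longrightarrow> \<exists>!u. is_arg_max (dual N V) (\<lambda>u. \<forall>j. 0 \<le> u $ j) u"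
    and polyhedral_constants: "0 < \<epsilon>" "0 < L"
    and polyhedral: "locally_polyhedral (dual N 1) (dual_max N 1) \<epsilon> L"
    and qla: "\<And>V. V \<ge> 1 \<Longrightarrow> qla N F S V (x_qla V)"
    and steady_state: "\<And>V. V \<ge> 1 \<Longrightarrow> has_steady_state M (backlog N S (x_qla V))"
    and fqla: "\<And>V. V \<ge> 1 \<Longrightarrow> fqla_ideal N F S V (x_fqla V)"
  shows "\<exists>(C::real) (c0::real) (V0::real). 0 < c0 \<and> 1 \<le> V0 \<and> (\<forall>V\<ge>V0.
      avg_backlog M (fqla_backlog N S V (x_fqla V)) \<le> ereal (C * (ln V)\<^sup>2) \<and>
      \<bar>avg_cost M N S (x_fqla V) - opt_avg_cost M F N S\<bar> \<le> ereal (C / V) \<and>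
      (filterlim (expected_generated M N S (x_fqla V)) at_top sequentially \<longrightarrow>
         drop_fraction M N S V (x_fqla V) \<le> ereal (C / V powr (c0 * ln V))))"
proof -
  interpret stochastic_network M F S N \<delta> by (rule model)
  let ?r = "real CARD('r)"
  \<comment> \<open>The smallest radius and the largest rate for which the exponential drift bound holds; neither
    depends on \<open>V\<close>.\<close>
  define D where "D = 3 * ?r * \<delta>\<^sup>2 / L"
  define \<eta> where "\<eta> = min (1 / (?r * \<delta>)) (L / (4 * (?r * \<delta>)\<^sup>2))"
  define q where "q = dual N 1 (dual_max N 1)"
  define K where "K = exp (\<eta> * D) / \<eta> * (1 + 16 * (?r * \<delta>) / L)"
  define Cb Cc Cd where "Cb = ?r * (1 + \<delta> + K)" and "Cc = 3 * ?r * \<delta>\<^sup>2 / 2"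
    and "Cd = 16 * (?r * \<delta>) * exp (\<eta> * D) / L"
  define C where "C = Cb + Cc + Cd"
  have r: "0 < ?r * \<delta>" using delta_pos by simp
  have D: "0 < D" "3 * ?r * \<delta>\<^sup>2 \<le> L * D"
    using delta_pos polyhedral_constants by (simp_all add: D_def)
  have "0 < 1 / (?r * \<delta>)" "0 < L / (4 * (?r * \<delta>)\<^sup>2)"
    using delta_pos polyhedral_constants by simp_all
  then have \<eta>: "0 < \<eta>" by (simp only: \<eta>_def min_less_iff_conj)
  have "\<eta> \<le> 1 / (?r * \<delta>)" "\<eta> \<le> L / (4 * (?r * \<delta>)\<^sup>2)" by (simp_all add: \<eta>_def)
  moreover have "0 < 4 * (?r * \<delta>)\<^sup>2" using delta_pos by simp
  ultimately have "\<eta> * (?r * \<delta>) \<le> 1" "\<eta> * (4 * (?r * \<delta>)\<^sup>2) \<le> L"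
    using pos_le_divide_eq r by blast+
  then have \<eta>': "\<eta> * (?r * \<delta>) \<le> 1" "\<eta> * (?r * \<delta>)\<^sup>2 \<le> L / 4"
    by (simp_all only: mult.left_commute[of \<eta> 4] pos_le_divide_eq[of 4] zero_less_numeral mult.commute[of _ 4])
  have K: "0 \<le> K" using \<eta> r polyhedral_constants by (simp add: K_def)
  have C: "0 \<le> Cb" "Cb \<le> C" "Cc \<le> C" "Cd \<le> C"
    using \<eta> r K delta_pos polyhedral_constants by (simp_all add: C_def Cb_def Cc_def Cd_def)
  have dual_slope: "0 \<le> dual_max N V $ j" "dual N V (dual_max N V) = V * q"
      "(\<And>j. 0 \<le> u $ j) \<Longrightarrow> dual N V u + L * norm (u - dual_max N V) \<le> dual N V (dual_max N V)"
    if "1 \<le> V" for V j u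
    unfolding q_def
    by (rule dual_slope_scaled[OF unique_maximizer polyhedral polyhedral_constants that]; assumption)+
  have dual_max_1: "0 \<le> dual_max N 1 $ j" for j using dual_slope(1)[of 1] by simp
  \<comment> \<open>From \<open>exp (max 1 D)\<close> on, \<open>(ln V)\<^sup>2\<close> exceeds the radius \<open>D\<close> and absorbs constants.\<close>
  have "1 \<le> exp (max 1 D)" by simp
  moreover have "avg_backlog M (fqla_backlog N S V (x_fqla V)) \<le> ereal (C * (ln V)\<^sup>2)"
    and "\<bar>avg_cost M N S (x_fqla V) - opt_avg_cost M F N S\<bar> \<le> ereal (C / V)"
    and "filterlim (expected_generated M N S (x_fqla V)) at_top sequentially \<Longrightarrow>
         drop_fraction M N S V (x_fqla V) \<le> ereal (C / V powr (\<eta> * ln V))"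
    if V: "exp (max 1 D) \<le> V" for V
  proof -
    have V1: "1 \<le> V" using V by (meson \<open>1 \<le> exp (max 1 D)\<close> order.trans)
    then have "max 1 D \<le> ln V" using V by (subst ln_ge_iff) auto
    then have ln_ge: "1 \<le> ln V" "D \<le> ln V" by simp_all
    then have "ln V \<le> (ln V)\<^sup>2"
      using mult_left_mono[of 1 "ln V" "ln V"] unfolding power2_eq_square by linarith
    with ln_ge have lnV: "1 \<le> (ln V)\<^sup>2" "D \<le> (ln V)\<^sup>2" by linarith+
    let ?x = "x_fqla V"
    interpret controlled_network M F S N \<delta> ?x "fqla_offset N V"
      using fqla[OF V1] by unfold_locales (simp_all add: fqla_ideal_def fqla_offset_def)
    interpret greedy_network M F S N \<delta> ?x "fqla_offset N V" V
    proof
      fix \<omega> t assume "\<omega> \<in> space M"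
      moreover have "fqla_virtual N S V ?x t \<omega> = W t \<omega>" by (simp add: fqla_virtual_def W_def)
      ultimately show "qla_action N V (W t \<omega>) (S t \<omega>) (?x t \<omega>)"
        using fqla[OF V1] by (metis fqla_ideal_def space_F)
    qed
    interpret fqla_network M F S N \<delta> ?x V L D \<eta>
    proof
      show "0 \<le> dual_max N V $ j" for j using V1 by (rule dual_slope(1))
      show "dual N V u + L * norm (u - dual_max N V) \<le> dual N V (dual_max N V)"
        if "\<And>j. 0 \<le> u $ j" for u using V1 that by (rule dual_slope(3))
    qed (use D \<eta> \<eta>' in simp_all)
    have "?r * ((ln V)\<^sup>2 + \<delta> + K) \<le> ?r * ((ln V)\<^sup>2 + \<delta> * (ln V)\<^sup>2 + K * (ln V)\<^sup>2)"
      using mult_left_mono[OF lnV(1) K] mult_left_mono[OF lnV(1), of \<delta>] delta_pos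
      by (intro mult_left_mono add_mono) simp_all
    also have "\<dots> = Cb * (ln V)\<^sup>2" by (simp add: Cb_def algebra_simps)
    also have "\<dots> \<le> C * (ln V)\<^sup>2" using C by (intro mult_right_mono) auto
    finally show "avg_backlog M (fqla_backlog N S V ?x) \<le> ereal (C * (ln V)\<^sup>2)"
      using fqla_avg_backlog_le by (simp add: mean_distance_bound_def K_def order.trans)
    show "\<bar>avg_cost M N S ?x - opt_avg_cost M F N S\<bar> \<le> ereal (C / V)"
    proof -
      have "avg_cost M N S ?x \<le> ereal (q + 3 * ?r * \<delta>\<^sup>2 / (2 * V))"
      proof (rule avg_cost_le)
        fix u :: "real ^ 'r" assume u: "\<And>j. 0 \<le> u $ j"
        have "0 \<le> L * norm (u - dual_max N V)" using polyhedral_constants by simp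
        then show "dual N V u \<le> V * q"
          using dual_slope(2)[OF V1] dual_slope(3)[OF V1 u] by linarith
      qed (use V1 in simp)
      also have "3 * ?r * \<delta>\<^sup>2 / (2 * V) = Cc / V" by (simp add: Cc_def)
      finally have upper: "avg_cost M N S ?x \<le> ereal (q + Cc / V)" by simp
      have opt_le: "opt_avg_cost M F N S \<le> avg_cost M N S ?x"
        unfolding opt_avg_cost_def using policy policy_stable by (intro INF_lower) simp
      have le_opt: "ereal q \<le> opt_avg_cost M F N S"
        unfolding opt_avg_cost_def q_def
        by (intro INF_greatest dual_le_avg_cost_stable) (auto simp: dual_max_1)
      obtain o' a' where o': "opt_avg_cost M F N S = ereal o'" and a': "avg_cost M N S ?x = ereal a'"
        using upper opt_le le_opt
        by (cases "opt_avg_cost M F N S"; cases "avg_cost M N S ?x") auto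
      have "Cc / V \<le> C / V" using C V1 by (intro divide_right_mono) auto
      then show ?thesis using upper opt_le le_opt unfolding o' a' by (simp add: abs_le_iff)
    qed
    show "drop_fraction M N S V ?x \<le> ereal (C / V powr (\<eta> * ln V))"
      if "filterlim (expected_generated M N S ?x) at_top sequentially"
    proof -
      have "V powr (\<eta> * ln V) = exp (\<eta> * (ln V)\<^sup>2)"
        using V1 by (simp add: powr_def power2_eq_square mult.assoc)
      then have "Cd * exp (- \<eta> * (ln V)\<^sup>2) = Cd / V powr (\<eta> * ln V)"
        by (simp add: exp_minus divide_inverse)
      also have "\<dots> \<le> C / V powr (\<eta> * ln V)" using C by (intro divide_right_mono) auto
      finally show ?thesis using drop_fraction_le[OF lnV(2) that]
        by (metis Cd_def ereal_less_eq(3) order.trans)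
    qed
  qed
  ultimately show ?thesis using \<eta> by blast
qed

end
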